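(* Let $m \ge 1$ and $0 \le k \le m-1$ be integers, and let $f : [0,\infty) \times \mathbb{R}^m \to [0,\infty)$ be a non-negative locally Caratheodory function. Let $q : [0,\infty) \to [0,\infty)$ be a locally integrable function, and let $h : [0,\infty) \to [0,\infty)$ be a non-decreasing continuous function such that $h(s) > 0$ for all $s \in (0,\infty)$. Suppose that $$f(t, x_0, \ldots, x_{m-1}) \le q(t)\, h(x_k)$$ for almost all $t \in [0,\infty)$ and for all $x_i \in [0,\infty)$, $i = 0, \ldots, m-1$. If $$\int_1^\infty h^{-1/(m-k)}(s)\, s^{1/(m-k) - 1}\, ds = \infty,$$ then, for any real numbers $a_0, \ldots, a_{m-1} \ge 0$, any solution of the Cauchy problem $$w^{(m)} = f(t, w, \ldots, w^{(m-1)}), \qquad w^{(i)}(0) = a_i, \quad i = 0, \ldots, m-1,$$ on an interval $[0,T)$, $0 < T \le \infty$, can be extended to a solution of this problem on the whole interval $[0,\infty)$.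
   Context: A function $f : [0,\infty) \times \mathbb{R}^m \to \mathbb{R}$ is locally Caratheodory if $f(\cdot, x)$ is measurable for every $x \in \mathbb{R}^m$, $f(t,\cdot)$ is continuous for almost all $t \in [0,\infty)$, and for every $r > 0$ the function $t \mapsto \sup_{|x| \le r} |f(t,x)|$ is bounded almost everywhere by a locally integrable function on $[0,\infty)$. Locally integrable on $[0,\infty)$ means Lebesgue integrable on $[0,b]$ for every $b > 0$. A function $w : [0,T) \to \mathbb{R}$, $0 < T \le \infty$, is called a solution of the equation $w^{(m)} = f(t, w, \ldots, w^{(m-1)})$ on $[0,T)$ if its derivatives $w^{(i)}$, $i = 0, \ldots, m-1$, are locally absolutely continuous on $[0,T)$ and the equation holds for almost all $t \in [0,T)$. It is a solution of the Cauchy problem if, in addition, it satisfies the initial conditions. A solution on $[0,T)$ can be extended to $[0,\infty)$ if there is a solution on $[0,\infty)$ coinciding with it on $[0,T)$. *)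

theory Defs
  imports "HOL-Analysis.Analysis"
begin

definition locally_integrable :: "(real \<Rightarrow> real) \<Rightarrow> bool" where
  "locally_integrable g \<longleftrightarrow> (\<forall>b>0. set_integrable lebesgue {0..b} g)"

(* Points of R^m are the elements of topspace (Euclidean_space m): sequences nat => real that
   vanish from index m on, with coordinates x 0, ..., x (m - 1).  Only the values f t x with
   t >= 0 and x in this set matter.  The supremum is taken in ereal, so that it is meaningful
   even for those t for which the set of values is unbounded. *)
definition locally_caratheodory :: "nat \<Rightarrow> (real \<Rightarrow> (nat \<Rightarrow> real) \<Rightarrow> real) \<Rightarrow> bool" where
  "locally_caratheodory m f \<longleftrightarrow>
     (\<forall>x \<in> topspace (Euclidean_space m). (\<lambda>t. f t x) \<in> borel_measurable (lebesgue_on {0..})) \<and>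
     (AE t in lebesgue_on {0..}. continuous_map (Euclidean_space m) euclideanreal (f t)) \<and>
     (\<forall>r>0. \<exists>g. locally_integrable g \<and>
        (AE t in lebesgue_on {0..}.
           (SUP x \<in> {x \<in> topspace (Euclidean_space m). L2_set x {..<m} \<le> r}. ereal \<bar>f t x\<bar>)
             \<le> ereal (g t)))"

(* A pair (u, v) in P stands for the interval [u, v]; the intervals may share endpoints. *)
definition abs_continuous_on_interval :: "real \<Rightarrow> real \<Rightarrow> (real \<Rightarrow> real) \<Rightarrow> bool" where
  "abs_continuous_on_interval a b g \<longleftrightarrow>
     (\<forall>\<epsilon>>0. \<exists>\<delta>>0. \<forall>P. finite P \<longrightarrow>
        (\<forall>(u, v) \<in> P. a \<le> u \<and> u \<le> v \<and> v \<le> b) \<longrightarrow>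
        pairwise (\<lambda>(u, v) (u', v'). {u<..<v} \<inter> {u'<..<v'} = {}) P \<longrightarrow>
        (\<Sum>(u, v) \<in> P. v - u) < \<delta> \<longrightarrow>
        (\<Sum>(u, v) \<in> P. \<bar>g v - g u\<bar>) < \<epsilon>)"

definition locally_abs_continuous_on :: "real set \<Rightarrow> (real \<Rightarrow> real) \<Rightarrow> bool" where
  "locally_abs_continuous_on S g \<longleftrightarrow>
     (\<forall>a b. a \<le> b \<longrightarrow> {a..b} \<subseteq> S \<longrightarrow> abs_continuous_on_interval a b g)"

definition upto_time :: "ereal \<Rightarrow> real set" where
  "upto_time T = {t. 0 \<le> t \<and> ereal t < T}"

(* Derivatives are relative to S, hence one-sided at the endpoint 0 of [0,T); on S they do not
   depend on the values of w outside S.  The value is arbitrary where the derivative fails to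
   exist, so existence has to be required separately. *)
primrec nth_deriv_within :: "real set \<Rightarrow> nat \<Rightarrow> (real \<Rightarrow> real) \<Rightarrow> real \<Rightarrow> real" where
  "nth_deriv_within S 0 w = w"
| "nth_deriv_within S (Suc i) w =
     (\<lambda>t. vector_derivative (nth_deriv_within S i w) (at t within S))"

definition jet :: "real set \<Rightarrow> nat \<Rightarrow> (real \<Rightarrow> real) \<Rightarrow> real \<Rightarrow> nat \<Rightarrow> real" where
  "jet S m w t = (\<lambda>i. if i < m then nth_deriv_within S i w t else 0)"

definition is_solution ::
    "nat \<Rightarrow> (real \<Rightarrow> (nat \<Rightarrow> real) \<Rightarrow> real) \<Rightarrow> ereal \<Rightarrow> (real \<Rightarrow> real) \<Rightarrow> bool" where
  "is_solution m f T w \<longleftrightarrow>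
     (let S = upto_time T in
       (\<forall>i. Suc i < m \<longrightarrow> nth_deriv_within S i w differentiable_on S) \<and>
       (\<forall>i<m. locally_abs_continuous_on S (nth_deriv_within S i w)) \<and>
       (AE t in lebesgue_on S.
          nth_deriv_within S (m - 1) w differentiable (at t within S) \<and>
          nth_deriv_within S m w t = f t (jet S m w t)))"

definition is_cauchy_solution ::
    "nat \<Rightarrow> (real \<Rightarrow> (nat \<Rightarrow> real) \<Rightarrow> real) \<Rightarrow> (nat \<Rightarrow> real) \<Rightarrow> ereal \<Rightarrow> (real \<Rightarrow> real) \<Rightarrow> bool" where
  "is_cauchy_solution m f a T w \<longleftrightarrow>
     is_solution m f T w \<and> (\<forall>i<m. nth_deriv_within (upto_time T) i w 0 = a i)"

end

theory Submission
  imports Defs "HOL-Complex_Analysis.Great_Picard"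
begin

text \<open>
  A solution on \<open>[0,T)\<close> with \<open>T < \<infinity>\<close> can be continued as soon as all its derivatives of order below
  \<open>m\<close> stay bounded near \<open>T\<close>. So the proof has two parts, an a priori bound and the existence of a
  solution of the initial value problem posed at time \<open>T\<close>. Both rest on a system of inequalities
  for the jet \<open>y i = w\<^sup>(\<^sup>i\<^sup>)\<close>, here called a growth chain: the \<open>y i\<close> are nonnegative and nondecreasing,
  \<open>y i\<close> grows at most with the speed \<open>y (i + 1)\<close>, and \<open>y (m - 1)\<close> grows over \<open>[s,t]\<close> by at most
  \<open>h (y k t)\<close> times the integral of \<open>q\<close>.

  The a priori bound (\<open>growth_chain_a_priori\<close>). It suffices to bound \<open>h (y k t)\<close>, which
  is clear if \<open>h\<close> is bounded. Otherwise let \<open>l = m - k\<close>, pick levels \<open>s\<^sub>j\<close> with \<open>h s\<^sub>j = 2\<^sup>j * h s\<^sub>0\<close>, let \<open>t\<^sub>j\<close> be a time at which \<open>y k\<close>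
  takes the value \<open>s\<^sub>j\<close>, and put \<open>V d j = y (m - d) t\<^sub>j / h s\<^sub>j\<close> for \<open>1 \<le> d \<le> l\<close>. Since \<open>h\<close> doubles from one level to
  the next, past contributions are halved: \<open>V 1 (j + 1)\<close> is at most \<open>V 1 j / 2\<close> plus the integral of \<open>q\<close> over
  the step, and \<open>V (d + 1) (j + 1)\<close> is at most \<open>V (d + 1) j / 2\<close> plus \<open>V d (j + 1)\<close> times the duration of the
  step. Roots of order \<open>d\<close> turn this into linear recursions with a contraction factor, and summation
  (\<open>halving_chain_sum_root_le\<close>) bounds the sum of the \<open>l\<close>-th roots of \<open>V l j = s\<^sub>j / h s\<^sub>j\<close> by a constant
  that depends only on \<open>l\<close>, the initial data, the elapsed time and the integral of \<open>q\<close>. Divergence of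
  the given integral makes these sums unbounded (\<open>dyadic_levels\<close>), so some level, which depends on
  these data only, is never passed.

  Existence (\<open>global_solution\<close>). Euler polygons evaluate the right-hand side at a state
  frozen in the past. By monotonicity of \<open>h\<close> they are themselves growth chains, so the a priori bound
  holds for them uniformly, on every compact interval of \<open>[T,\<infinity>)\<close>. This gives equicontinuity and an
  integrable majorant, and a subsequence converges to a solution on all of \<open>[T,\<infinity>)\<close> at once.

  Finally the two pieces are glued at \<open>T\<close>. Regularity of the result need not be discussed separately
  at the junction, since it follows from the growth chain inequalities on \<open>[0,\<infinity>)\<close> together with lower
  bounds for the slopes (\<open>growth_chain_solution\<close>).
\<close>

section \<open>Differentiation almost everywhere and absolute continuity\<close>

lemma AE_lebesgue_on_iff_negligible:
  fixes S :: "real set"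
  assumes "S \<in> sets lebesgue"
  shows "(AE t in lebesgue_on S. P t) \<longleftrightarrow> (\<exists>N. negligible N \<and> (\<forall>t\<in>S - N. P t))"
proof -
  have "(AE t in lebesgue_on S. P t) \<longleftrightarrow> (AE t in lebesgue. t \<in> S \<longrightarrow> P t)"
    using assms by (simp add: AE_restrict_space_iff)
  also have "\<dots> \<longleftrightarrow> (\<exists>N. negligible N \<and> (\<forall>t\<in>S - N. P t))"
    unfolding eventually_ae_filter negligible_iff_null_sets by auto
  finally show ?thesis .
qed

text \<open>
  Off a null set the averages of \<open>\<phi>\<close> over \<open>[t, t + h]\<close> tend to \<open>\<phi> t\<close>. The averages over
  \<open>[t - h, t]\<close> are those of the reflected function \<open>\<lambda>t. \<phi> (- t)\<close>, so the same fact applied twice gives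
  both one-sided derivatives.
\<close>

lemma has_vector_derivative_integral_ae:
  fixes \<phi> :: "real \<Rightarrow> real"
  assumes int: "\<And>b. a \<le> b \<Longrightarrow> \<phi> integrable_on {a..b}"
  obtains N where "negligible N"
    "\<And>t. a < t \<Longrightarrow> t \<notin> N \<Longrightarrow>
       ((\<lambda>u. integral {a..u} \<phi>) has_vector_derivative \<phi> t) (at t)"
proof -
  define g where "g t = (if t \<in> {a..} then \<phi> t else 0)" for t
  have g_int: "g integrable_on cbox c d" for c d
  proof -
    have "g integrable_on {a..max a d}"
      by (rule integrable_eq[OF int[of "max a d"]]) (auto simp: g_def)
    hence "(\<lambda>x. if x \<in> {a..max a d} then g x else 0) integrable_on UNIV"
      by (subst integrable_restrict_UNIV)
    hence "(\<lambda>x. if x \<in> {a..max a d} then g x else 0) integrable_on {c..d}"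
      by (rule integrable_on_subinterval) auto
    moreover have "(if x \<in> {a..max a d} then g x else 0) = g x" if "x \<in> {c..d}" for x
      using that by (auto simp: g_def)
    ultimately show ?thesis
      unfolding box_real by (rule integrable_eq)
  qed
  have g'_int: "(\<lambda>t. g (- t)) integrable_on cbox c d" for c d
    by (subst integrable_reflect[symmetric]) (simp add: g_int[unfolded box_real])
  obtain N1 where N1: "negligible N1" "\<And>x e. \<lbrakk>x \<notin> N1; 0 < e\<rbrakk> \<Longrightarrow>
      \<exists>d>0. \<forall>h. 0 < h \<and> h < d \<longrightarrow> norm (integral (cbox x (x + h *\<^sub>R One)) g /\<^sub>R h ^ DIM(real) - g x) < e"
    by (rule integrable_ccontinuous_explicit[of g, OF g_int]) (rule that, assumption+)
  obtain N2 where N2: "negligible N2" "\<And>x e. \<lbrakk>x \<notin> N2; 0 < e\<rbrakk> \<Longrightarrow>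
      \<exists>d>0. \<forall>h. 0 < h \<and> h < d \<longrightarrow> norm (integral (cbox x (x + h *\<^sub>R One)) (\<lambda>t. g (-t)) /\<^sub>R h ^ DIM(real) - g (-x)) < e"
    by (rule integrable_ccontinuous_explicit[of "\<lambda>t. g (-t)", OF g'_int]) (rule that, assumption+)
  have "negligible (uminus ` N2)"
    by (rule negligible_differentiable_image_negligible[OF _ N2(1)]) (auto intro!: derivative_intros)
  with N1(1) have "negligible (N1 \<union> uminus ` N2)" by simp
  moreover have "((\<lambda>u. integral {a..u} \<phi>) has_vector_derivative \<phi> t) (at t)"
    if t: "a < t" "t \<notin> N1 \<union> uminus ` N2" for t
  proof -
    have tN: "t \<notin> N1" "- t \<notin> N2" using t(2) by force+
    have "\<exists>d>0. \<forall>y\<in>UNIV. norm (y - t) < d \<longrightarrow>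
        norm (integral {a..y} \<phi> - integral {a..t} \<phi> - (y - t) *\<^sub>R \<phi> t) \<le> e * norm (y - t)"
      if "e > 0" for e
    proof -
      obtain d1 where d1: "d1 > 0"
        "\<And>h. 0 < h \<Longrightarrow> h < d1 \<Longrightarrow> \<bar>integral {t..t+h} g / h - g t\<bar> < e"
        using N1(2)[OF tN(1) \<open>e > 0\<close>] by (force simp: divide_inverse mult.commute)
      obtain d2 where d2: "d2 > 0"
        "\<And>h. 0 < h \<Longrightarrow> h < d2 \<Longrightarrow> \<bar>integral {-t..-t+h} (\<lambda>u. g (-u)) / h - g t\<bar> < e"
        using N2(2)[OF tN(2) \<open>e > 0\<close>] by (force simp: divide_inverse mult.commute)
      show ?thesis
      proof (intro exI[of _ "min (t - a) (min d1 d2)"] conjI ballI impI)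
        show "0 < min (t - a) (min d1 d2)" using d1 d2 t by simp
        fix y assume y: "norm (y - t) < min (t - a) (min d1 d2)"
        have ya: "a < y" using y by (auto simp: abs_if split: if_splits)
        have gphi: "integral {u..v} g = integral {u..v} \<phi>" if "a \<le> u" for u v
          by (rule integral_cong) (use that in \<open>auto simp: g_def\<close>)
        consider "y = t" | "y > t" | "y < t" by linarith
        then show "norm (integral {a..y} \<phi> - integral {a..t} \<phi> - (y - t) *\<^sub>R \<phi> t) \<le> e * norm (y - t)"
        proof cases
          case 1 then show ?thesis by simp
        next
          case 2
          have "integral {a..t} \<phi> + integral {t..y} \<phi> = integral {a..y} \<phi>"
            by (rule Henstock_Kurzweil_Integration.integral_combine) (use 2 t int ya in auto)
          moreover have "\<bar>integral {t..y} \<phi> / (y-t) - \<phi> t\<bar> < e"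
            using d1(2)[of "y-t"] y 2 t gphi[of t y] by (auto simp: g_def)
          hence "\<bar>integral {t..y} \<phi> - (y-t) * \<phi> t\<bar> < e * (y-t)"
            using 2 by (simp add: abs_less_iff field_simps)
          ultimately show ?thesis using 2 by (simp add: algebra_simps)
        next
          case 3
          have "integral {a..y} \<phi> + integral {y..t} \<phi> = integral {a..t} \<phi>"
            by (rule Henstock_Kurzweil_Integration.integral_combine) (use 3 t int ya in auto)
          moreover have "integral {-t..-y} (\<lambda>u. g (-u)) = integral {y..t} \<phi>"
            using gphi[of y t] ya by (simp add: Henstock_Kurzweil_Integration.integral_reflect_real)
          hence "\<bar>integral {y..t} \<phi> / (t-y) - \<phi> t\<bar> < e"
            using d2(2)[of "t-y"] y 3 t by (auto simp: g_def)
          hence "\<bar>integral {y..t} \<phi> - (t-y) * \<phi> t\<bar> < e * (t-y)"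
            using 3 by (simp add: abs_less_iff field_simps)
          ultimately show ?thesis using 3 by (simp add: algebra_simps abs_less_iff abs_le_iff)
        qed
      qed
    qed
    then show ?thesis
      unfolding has_vector_derivative_def has_derivative_within_alt
      by (simp add: bounded_linear_mult_left)
  qed
  ultimately show thesis using that by blast
qed

text \<open>
  The open intervals are pairwise disjoint, so the sum of the restrictions of \<open>p\<close> to them stays
  below \<open>p\<close>.
\<close>

lemma sum_integral_nonoverlapping_le:
  fixes p :: "real \<Rightarrow> real"
  assumes p: "p integrable_on {a..b}" "\<And>t. t \<in> {a..b} \<Longrightarrow> 0 \<le> p t"
    and P: "finite P" "\<And>u v. (u, v) \<in> P \<Longrightarrow> a \<le> u \<and> u \<le> v \<and> v \<le> b"
    and disj: "pairwise (\<lambda>(u, v) (u', v'). {u<..<v} \<inter> {u'<..<v'} = {}) P"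
  shows "(\<Sum>(u, v)\<in>P. integral {u..v} p) \<le> integral {a..b} p"
proof -
  define c where "c z x = (if x \<in> {fst z<..<snd z} then p x else 0)" for z x
  have hi: "(c (u,v) has_integral integral {u..v} p) {a..b}" if "(u,v) \<in> P" for u v
  proof -
    have uv: "a \<le> u" "u \<le> v" "v \<le> b" using P(2)[OF that] by auto
    have "p integrable_on {u..v}"
      by (rule integrable_on_subinterval[OF p(1)]) (use uv in auto)
    hence "(p has_integral integral {u..v} p) {u..v}" by (rule integrable_integral)
    hence "(p has_integral integral {u..v} p) {u<..<v}"
      by (simp add: has_integral_Icc_iff_Ioo)
    hence "((\<lambda>x. if x \<in> {u<..<v} then p x else 0) has_integral integral {u..v} p) {a..b}"
      by (subst has_integral_restrict) (use uv in auto)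
    thus ?thesis by (simp add: c_def[abs_def])
  qed
  have "((\<lambda>x. \<Sum>z\<in>P. c z x) has_integral (\<Sum>z\<in>P. integral {fst z..snd z} p)) {a..b}"
    by (rule has_integral_sum[OF P(1)]) (use hi in force)
  moreover have "(p has_integral integral {a..b} p) {a..b}" using p(1) by (rule integrable_integral)
  moreover have "(\<Sum>z\<in>P. c z x) \<le> p x" if x: "x \<in> {a..b}" for x
  proof (cases "\<exists>z\<in>P. x \<in> {fst z<..<snd z}")
    case True
    then obtain z where z: "z \<in> P" "x \<in> {fst z<..<snd z}" by blast
    have "c z' x = 0" if "z' \<in> P - {z}" for z'
    proof -
      have "{fst z<..<snd z} \<inter> {fst z'<..<snd z'} = {}"
        using pairwiseD[OF disj, of z z'] that z(1) by (auto simp: case_prod_unfold)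
      thus ?thesis using z(2) by (auto simp: c_def)
    qed
    hence "(\<Sum>z\<in>P. c z x) = c z x"
      using P(1) z(1) by (subst sum.remove[of _ z]) auto
    also have "\<dots> = p x" using z by (simp add: c_def)
    finally show ?thesis by simp
  next
    case False
    hence "(\<Sum>z\<in>P. c z x) = 0" by (intro sum.neutral) (auto simp: c_def)
    thus ?thesis using p(2)[OF x] by simp
  qed
  ultimately have "(\<Sum>z\<in>P. integral {fst z..snd z} p) \<le> integral {a..b} p"
    by (rule has_integral_le)
  thus ?thesis by (simp add: case_prod_unfold)
qed

text \<open>
  Absolute continuity of the integral: \<open>p\<close> is the sum of a bounded function, whose integral is
  Lipschitz, and of a remainder with small integral.
\<close>

lemma abs_continuous_on_interval_dominated:
  fixes p :: "real \<Rightarrow> real"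
  assumes p: "p integrable_on {a..b}" "\<And>t. t \<in> {a..b} \<Longrightarrow> 0 \<le> p t"
    and dom: "\<And>u v. a \<le> u \<Longrightarrow> u \<le> v \<Longrightarrow> v \<le> b \<Longrightarrow> \<bar>g v - g u\<bar> \<le> integral {u..v} p"
  shows "abs_continuous_on_interval a b g"
  unfolding abs_continuous_on_interval_def
proof (intro allI impI)
  fix e :: real assume e: "e > 0"
  \<comment> \<open>the truncations increase to \<open>p\<close>, so one of them carries all but \<open>e / 2\<close> of its integral\<close>
  define c where "c n t = min (p t) (real n)" for n t
  have c_int: "c n integrable_on {a..b}" for n
  proof -
    have "p absolutely_integrable_on {a..b}"
      using p nonnegative_absolutely_integrable_1 by blast
    moreover have "(\<lambda>_. real n) absolutely_integrable_on {a..b}"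
      by (rule absolutely_integrable_on_const) simp
    ultimately have "(\<lambda>t. min (p t) (real n)) absolutely_integrable_on {a..b}"
      by (rule absolutely_integrable_min_1)
    thus ?thesis by (simp add: c_def[abs_def] set_lebesgue_integral_eq_integral(1))
  qed
  have "(\<lambda>n. integral {a..b} (c n)) \<longlonglongrightarrow> integral {a..b} p"
  proof (rule dominated_convergence(2)[OF c_int p(1)])
    show "norm (c n t) \<le> p t" if "t \<in> {a..b}" for n t
      using p(2)[OF that] by (auto simp: c_def)
    show "(\<lambda>n. c n t) \<longlonglongrightarrow> p t" if "t \<in> {a..b}" for t
    proof (rule tendsto_eventually)
      obtain N where "p t \<le> real N" using real_arch_simple by blast
      thus "\<forall>\<^sub>F n in sequentially. c n t = p t"
        by (auto simp: c_def min_def eventually_sequentially intro!: exI[of _ N])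
    qed
  qed
  from LIMSEQ_D[OF this, of "e/2"] e obtain n
    where "norm (integral {a..b} (c n) - integral {a..b} p) < e/2" by (metis half_gt_zero le_refl)
  hence n: "integral {a..b} p - integral {a..b} (c n) < e/2" by (simp add: abs_if split: if_splits)
  have d_int: "(\<lambda>t. p t - c n t) integrable_on {a..b}" by (intro integrable_diff p c_int)
  show "\<exists>\<delta>>0. \<forall>P. finite P \<longrightarrow> (\<forall>(u, v)\<in>P. a \<le> u \<and> u \<le> v \<and> v \<le> b) \<longrightarrow>
        pairwise (\<lambda>(u, v) (u', v'). {u<..<v} \<inter> {u'<..<v'} = {}) P \<longrightarrow>
        (\<Sum>(u, v)\<in>P. v - u) < \<delta> \<longrightarrow> (\<Sum>(u, v)\<in>P. \<bar>g v - g u\<bar>) < e"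
  proof (intro exI[of _ "e / (2 * (real n + 1))"] conjI allI impI)
    show "0 < e / (2 * (real n + 1))" using e by simp
    fix P assume P: "finite P" "\<forall>(u, v)\<in>P. a \<le> u \<and> u \<le> v \<and> v \<le> b"
      "pairwise (\<lambda>(u, v) (u', v'). {u<..<v} \<inter> {u'<..<v'} = {}) P"
      "(\<Sum>(u, v)\<in>P. v - u) < e / (2 * (real n + 1))"
    have one: "\<bar>g v - g u\<bar> \<le> integral {u..v} (\<lambda>t. p t - c n t) + real n * (v - u)" if "(u, v) \<in> P" for u v
    proof -
      have uv: "a \<le> u" "u \<le> v" "v \<le> b" using P(2) that by auto
      have sub: "{u..v} \<subseteq> {a..b}" using uv by auto
      note I = integrable_on_subinterval[OF _ sub]
      have "integral {u..v} p \<le> integral {u..v} (\<lambda>t. (p t - c n t) + real n)"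
        using I[OF p(1)] I[OF d_int]
        by (intro integral_le integrable_add) (auto simp: c_def)
      also have "\<dots> = integral {u..v} (\<lambda>t. p t - c n t) + real n * (v - u)"
        using uv by (subst Henstock_Kurzweil_Integration.integral_add) (auto intro: I[OF d_int])
      finally show ?thesis using dom[OF uv] by linarith
    qed
    have "(\<Sum>(u, v)\<in>P. \<bar>g v - g u\<bar>) \<le> (\<Sum>(u, v)\<in>P. integral {u..v} (\<lambda>t. p t - c n t) + real n * (v - u))"
      by (rule sum_mono) (use one in auto)
    also have "\<dots> = (\<Sum>(u, v)\<in>P. integral {u..v} (\<lambda>t. p t - c n t)) + real n * (\<Sum>(u, v)\<in>P. v - u)"
      by (simp add: case_prod_unfold sum.distrib sum_distrib_left)
    also have "(\<Sum>(u, v)\<in>P. integral {u..v} (\<lambda>t. p t - c n t)) \<le> integral {a..b} (\<lambda>t. p t - c n t)"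
      by (rule sum_integral_nonoverlapping_le[OF d_int _ P(1) _ P(3)]) (use P(2) in \<open>auto simp: c_def\<close>)
    also have "\<dots> = integral {a..b} p - integral {a..b} (c n)"
      by (rule Henstock_Kurzweil_Integration.integral_diff[OF p(1) c_int])
    also have "\<dots> < e / 2" by (rule n)
    also have "real n * (\<Sum>(u, v)\<in>P. v - u) \<le> real n * (e / (2 * (real n + 1)))"
      using P(4) by (intro mult_left_mono) auto
    also have "\<dots> \<le> e / 2" using e by (simp add: field_simps)
    finally show "(\<Sum>(u, v)\<in>P. \<bar>g v - g u\<bar>) < e" by simp
  qed
qed

text \<open>
  This is how a differential inequality that holds almost everywhere is integrated: with \<open>g = 0\<close> it
  shows that an absolutely continuous function with nonpositive derivative is nonincreasing. The proof
  compares the telescoping sum of increments over a fine tagged division with a Riemann sum of \<open>g\<close>.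
  Absolute continuity enters only for the cells tagged in the exceptional set \<open>N\<close>, which have small
  total length.
\<close>

lemma abs_continuous_on_interval_increment_le:
  fixes u g :: "real \<Rightarrow> real"
  assumes ab: "a \<le> b" and ac: "abs_continuous_on_interval a b u" and N: "negligible N"
    and g: "g integrable_on {a..b}"
    and deriv: "\<And>t. t \<in> {a..b} - N \<Longrightarrow>
      \<exists>D. (u has_vector_derivative D) (at t within {a..b}) \<and> D \<le> g t"
  shows "u b - u a \<le> integral {a..b} g"
proof (rule field_le_epsilon)
  fix e :: real assume e: "e > 0"
  define \<epsilon> where "\<epsilon> = e / (3 * (b - a + 1))"
  have \<epsilon>: "\<epsilon> > 0" "\<epsilon> * (b - a) \<le> e / 3" using e ab by (auto simp: \<epsilon>_def field_simps)
  define g0 where "g0 t = (if t \<in> N then 0 else g t)" for t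
  have "(g has_integral integral {a..b} g) {a..b}" using g by (rule integrable_integral)
  hence "(g0 has_integral integral {a..b} g) {a..b}"
    by (rule has_integral_spike[OF N, rotated]) (auto simp: g0_def)
  then obtain \<gamma>1 where \<gamma>1: "gauge \<gamma>1"
    "\<And>\<D>. \<D> tagged_division_of {a..b} \<Longrightarrow> \<gamma>1 fine \<D> \<Longrightarrow>
        norm ((\<Sum>(x,k)\<in>\<D>. measure lborel k *\<^sub>R g0 x) - integral {a..b} g) < e/3"
    using e unfolding has_integral_real by (metis divide_pos_pos zero_less_numeral)
  obtain \<delta> where \<delta>: "\<delta> > 0" "\<And>P. finite P \<Longrightarrow>
        (\<forall>(u, v) \<in> P. a \<le> u \<and> u \<le> v \<and> v \<le> b) \<Longrightarrow>
        pairwise (\<lambda>(u, v) (u', v'). {u<..<v} \<inter> {u'<..<v'} = {}) P \<Longrightarrow>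
        (\<Sum>(u, v) \<in> P. v - u) < \<delta> \<Longrightarrow>
        (\<Sum>(x, y) \<in> P. \<bar>u y - u x\<bar>) < e/3"
  proof -
    have "e / 3 > 0" using e by simp
    from ac[unfolded abs_continuous_on_interval_def, rule_format, OF this] show thesis
      by (elim exE conjE) (rule that, assumption, blast)
  qed
  obtain U where U: "open U" "N \<subseteq> U" "U \<in> lmeasurable" "measure lebesgue U < \<delta>"
  proof -
    obtain U where U: "open U" "N \<subseteq> U" "U - N \<in> lmeasurable" "emeasure lebesgue (U - N) < ennreal \<delta>"
      by (rule sets_lebesgue_outer_open[OF negligible_imp_sets[OF N] \<delta>(1)])
    have "(U - N) \<union> N \<in> lmeasurable"
      by (intro fmeasurable.Un U(3) negligible_imp_measurable N)
    moreover have "(U - N) \<union> N = U" using U(2) by blast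
    ultimately have Um: "U \<in> lmeasurable" by simp
    have "measure lebesgue U = measure lebesgue (U - N)"
      using N Um by (simp add: measure_Diff_null_set negligible_iff_null_sets fmeasurableD)
    also have "\<dots> < \<delta>"
      using U(3,4) \<delta>(1) by (simp add: emeasure_eq_measure2 ennreal_less_iff)
    finally show thesis using that U(1,2) Um by blast
  qed
  have "\<exists>r>0. \<forall>y\<in>{a..b}. \<bar>y - t\<bar> < r \<longrightarrow> \<bar>u y - u t - (y - t) * D\<bar> \<le> \<epsilon> * \<bar>y - t\<bar>"
    if "(u has_vector_derivative D) (at t within {a..b})" for t D
    using that \<epsilon>(1) unfolding has_vector_derivative_def has_derivative_within_alt by (simp add: mult.commute)
  hence "\<forall>t\<in>{a..b} - N. \<exists>D r. r > 0 \<and> D \<le> g t \<and>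
      (\<forall>y\<in>{a..b}. \<bar>y - t\<bar> < r \<longrightarrow> \<bar>u y - u t - (y - t) * D\<bar> \<le> \<epsilon> * \<bar>y - t\<bar>)"
    using deriv by meson
  then obtain D \<rho> where D: "\<And>t. t \<in> {a..b} - N \<Longrightarrow> \<rho> t > 0 \<and> D t \<le> g t"
    "\<And>t y. t \<in> {a..b} - N \<Longrightarrow> y \<in> {a..b} \<Longrightarrow> \<bar>y - t\<bar> < \<rho> t \<Longrightarrow>
        \<bar>u y - u t - (y - t) * D t\<bar> \<le> \<epsilon> * \<bar>y - t\<bar>"
    by metis
  \<comment> \<open>a cell tagged in \<open>N\<close> must lie in \<open>U\<close>; any other cell is short enough for the derivative at its tag\<close>
  define \<gamma>2 where "\<gamma>2 t = (if t \<in> N then U else if t \<in> {a..b} then ball t (\<rho> t) else UNIV)" for t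
  have "gauge \<gamma>2" using U D(1) by (auto simp: gauge_def \<gamma>2_def)
  with \<gamma>1(1) have "gauge (\<lambda>t. \<gamma>1 t \<inter> \<gamma>2 t)" by (rule gauge_Int)
  then obtain p where p: "p tagged_division_of {a..b}" "(\<lambda>t. \<gamma>1 t \<inter> \<gamma>2 t) fine p"
    using fine_division_exists_real by blast
  have fine: "\<gamma>1 fine p" "\<gamma>2 fine p" using p(2) by (auto simp: fine_def)
  have fin: "finite p" using p(1) by (rule tagged_division_of_finite)
  have cell: "\<exists>c d. K = {c..d} \<and> c \<le> d \<and> a \<le> c \<and> d \<le> b \<and> x \<in> {c..d}" if xK: "(x, K) \<in> p" for x K
  proof -
    obtain c d where "K = {c..d}" using tagged_division_ofD(4)[OF p(1) xK] unfolding box_real by blast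
    moreover have "x \<in> K" "K \<subseteq> {a..b}" using tagged_division_ofD(2,3)[OF p(1) xK] by auto
    ultimately show ?thesis by (intro exI[of _ c] exI[of _ d]) auto
  qed
  define pN where "pN = {z\<in>p. fst z \<in> N}"
  define I where "I z = (Inf (snd z :: real set), Sup (snd z))" for z :: "real \<times> real set"
  have I: "I (x, K) = (c, d)" if "K = {c..d}" "c \<le> d" for x K c d using that by (simp add: I_def)
  have Ip: "fst (I z) \<le> snd (I z) \<and> snd z = {fst (I z)..snd (I z)} \<and> a \<le> fst (I z) \<and> snd (I z) \<le> b
      \<and> fst z \<in> {fst (I z)..snd (I z)}" if "z \<in> p" for z
    using cell[of "fst z" "snd z"] that I[of "snd z" _ _ "fst z"] by fastforce
  have disj: "{fst (I z)<..<snd (I z)} \<inter> {fst (I z')<..<snd (I z')} = {}"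
    if "z \<in> p" "z' \<in> p" "z \<noteq> z'" for z z'
    using tagged_division_ofD(5)[OF p(1), of "fst z" "snd z" "fst z'" "snd z'"] that
      Ip[OF that(1)] Ip[OF that(2)] interior_atLeastAtMost_real by (metis prod.collapse)
  have "u b - u a = (\<Sum>z\<in>p. u (snd (I z)) - u (fst (I z)))"
    using additive_tagged_division_1[OF ab p(1), of u] by (simp add: I_def case_prod_unfold)
  also have "\<dots> = (\<Sum>z\<in>pN. u (snd (I z)) - u (fst (I z))) + (\<Sum>z\<in>p - pN. u (snd (I z)) - u (fst (I z)))"
    using sum.subset_diff[OF _ fin, of pN "\<lambda>z. u (snd (I z)) - u (fst (I z))"]
    by (auto simp: pN_def add.commute)
  also have "(\<Sum>z\<in>pN. u (snd (I z)) - u (fst (I z))) \<le> (\<Sum>z\<in>pN. \<bar>u (snd (I z)) - u (fst (I z))\<bar>)"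
    by (rule sum_mono) auto
  also have "\<dots> = (\<Sum>(x, y)\<in>I ` pN. \<bar>u y - u x\<bar>)"
  proof (subst sum.reindex_nontrivial)
    show "finite pN" using fin by (simp add: pN_def)
    fix z z' assume z: "z \<in> pN" "z' \<in> pN" "z \<noteq> z'" "I z = I z'"
    hence "{fst (I z)<..<snd (I z)} = {}" using disj[of z z'] by (auto simp: pN_def)
    hence "fst (I z) = snd (I z)" using Ip[of z] z(1) by (auto simp: pN_def)
    thus "(case I z of (x, y) \<Rightarrow> \<bar>u y - u x\<bar>) = 0" by (simp add: case_prod_unfold)
  qed (simp add: case_prod_unfold)
  also have "\<dots> < e / 3"
  proof (rule \<delta>(2))
    show fI: "finite (I ` pN)" using fin by (simp add: pN_def)
    show "\<forall>(x, y)\<in>I ` pN. a \<le> x \<and> x \<le> y \<and> y \<le> b" using Ip by (auto simp: pN_def case_prod_unfold)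
    have pw: "{fst w<..<snd w} \<inter> {fst w'<..<snd w'} = {}" if "w \<in> I ` pN" "w' \<in> I ` pN" "w \<noteq> w'" for w w'
      using that disj by (auto simp: pN_def)
    thus "pairwise (\<lambda>(u, v) (u', v'). {u<..<v} \<inter> {u'<..<v'} = {}) (I ` pN)"
      by (auto simp: pairwise_def case_prod_unfold)
    have "(\<Sum>(x, y)\<in>I ` pN. y - x) = (\<Sum>w\<in>I ` pN. measure lebesgue {fst w<..<snd w})"
      using Ip by (intro sum.cong) (auto simp: pN_def case_prod_unfold)
    also have "\<dots> = measure lebesgue (\<Union>w\<in>I ` pN. {fst w<..<snd w})"
      by (rule measure_UNION'[symmetric, OF fI]) (use pw in \<open>auto simp: pairwise_def disjnt_def\<close>)
    also have "\<dots> \<le> measure lebesgue U"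
    proof (rule measure_mono_fmeasurable[OF _ _ U(3)])
      have "snd z \<subseteq> U" if "z \<in> pN" for z
        using that fine(2) by (fastforce simp: pN_def fine_def \<gamma>2_def)
      thus "(\<Union>w\<in>I ` pN. {fst w<..<snd w}) \<subseteq> U"
        using Ip by (fastforce simp: pN_def)
      show "(\<Union>w\<in>I ` pN. {fst w<..<snd w}) \<in> sets lebesgue"
        using fI by (intro sets.finite_UN) auto
    qed
    also have "\<dots> < \<delta>" by (rule U)
    finally show "(\<Sum>(x, y)\<in>I ` pN. y - x) < \<delta>" .
  qed
  also have "(\<Sum>z\<in>p - pN. u (snd (I z)) - u (fst (I z))) \<le> (\<Sum>z\<in>p - pN. measure lborel (snd z) * (g0 (fst z) + \<epsilon>))"
  proof (rule sum_mono)
    fix z assume "z \<in> p - pN"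
    then have zp: "z \<in> p" and zN: "fst z \<notin> N" by (auto simp: pN_def)
    define x c d where "x = fst z" "c = fst (I z)" "d = snd (I z)"
    have cd: "c \<le> d" "snd z = {c..d}" "a \<le> c" "d \<le> b" "x \<in> {c..d}"
      using Ip[OF zp] by (auto simp: x_c_d_def)
    have xab: "x \<in> {a..b} - N" using cd zN by (auto simp: x_c_d_def)
    have "{c..d} \<subseteq> ball x (\<rho> x)"
    proof -
      have "snd z \<subseteq> \<gamma>2 (fst z)" using fine(2) zp by (metis fineD prod.collapse)
      thus ?thesis using zN xab cd(2) by (simp add: \<gamma>2_def x_c_d_def)
    qed
    moreover have "c \<in> {c..d}" "d \<in> {c..d}" using cd(1) by auto
    ultimately have "c \<in> ball x (\<rho> x)" "d \<in> ball x (\<rho> x)" by blast+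
    hence near: "\<bar>c - x\<bar> < \<rho> x" "\<bar>d - x\<bar> < \<rho> x" by (auto simp: dist_real_def)
    have "\<bar>u c - u x - (c - x) * D x\<bar> \<le> \<epsilon> * \<bar>c - x\<bar>" "\<bar>u d - u x - (d - x) * D x\<bar> \<le> \<epsilon> * \<bar>d - x\<bar>"
      by (intro D(2)[OF xab] near; use cd in simp)+
    moreover have "\<bar>c - x\<bar> = x - c" "\<bar>d - x\<bar> = d - x" using cd by auto
    ultimately have "u d - u c \<le> (d - c) * D x + \<epsilon> * (d - c)"
      by (simp add: abs_le_iff algebra_simps)
    also have "\<dots> \<le> (d - c) * (g0 x + \<epsilon>)"
    proof -
      have "(d - c) * D x \<le> (d - c) * g0 x"
        using D(1)[OF xab] cd(1) xab by (intro mult_left_mono) (auto simp: g0_def)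
      thus ?thesis by (simp add: algebra_simps)
    qed
    finally show "u (snd (I z)) - u (fst (I z)) \<le> measure lborel (snd z) * (g0 (fst z) + \<epsilon>)"
      using cd by (simp add: x_c_d_def)
  qed
  also have "\<dots> \<le> (\<Sum>z\<in>p. measure lborel (snd z) * (g0 (fst z) + (if z \<in> pN then 0 else \<epsilon>)))"
  proof -
    have "(\<Sum>z\<in>pN. measure lborel (snd z) * (g0 (fst z) + (if z \<in> pN then 0 else \<epsilon>))) = 0"
      by (intro sum.neutral) (auto simp: pN_def g0_def)
    moreover have "(\<Sum>z\<in>p - pN. measure lborel (snd z) * (g0 (fst z) + (if z \<in> pN then 0 else \<epsilon>)))
        = (\<Sum>z\<in>p - pN. measure lborel (snd z) * (g0 (fst z) + \<epsilon>))"
      by (intro sum.cong) auto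
    ultimately show ?thesis
      using sum.subset_diff[of pN p "\<lambda>z. measure lborel (snd z) * (g0 (fst z) + (if z \<in> pN then 0 else \<epsilon>))"] fin
      by (simp add: pN_def)
  qed
  also have "\<dots> \<le> (\<Sum>z\<in>p. measure lborel (snd z) * (g0 (fst z) + \<epsilon>))"
    using \<epsilon> by (intro sum_mono mult_left_mono) auto
  also have "\<dots> = (\<Sum>(x, K)\<in>p. measure lborel K *\<^sub>R g0 x) + \<epsilon> * (\<Sum>(x, K)\<in>p. measure lborel K)"
    by (simp add: case_prod_unfold sum.distrib sum_distrib_left algebra_simps)
  also have "(\<Sum>(x, K)\<in>p. measure lborel K) = b - a"
    using additive_content_tagged_division[of p a b] p(1) ab by simp
  also have "(\<Sum>(x, K)\<in>p. measure lborel K *\<^sub>R g0 x) \<le> integral {a..b} g + e / 3"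
    using \<gamma>1(2)[OF p(1) fine(1)] unfolding real_norm_def by linarith
  finally show "u b - u a \<le> integral {a..b} g + e" using \<epsilon>(2) by simp
qed

section \<open>Growth chains\<close>

text \<open>
  The inequalities that the jet \<open>y i = w\<^sup>(\<^sup>i\<^sup>)\<close> of a solution satisfies when \<open>Q\<close> is a
  primitive of \<open>q\<close>. They are stated without derivatives, because in this form they pass to pointwise
  limits and hold for Euler polygons, which are not solutions.
\<close>

definition growth_chain ::
    "nat \<Rightarrow> nat \<Rightarrow> (real \<Rightarrow> real) \<Rightarrow> (real \<Rightarrow> real) \<Rightarrow> real set \<Rightarrow> (nat \<Rightarrow> real \<Rightarrow> real) \<Rightarrow> bool" where
  "growth_chain m k h Q I y \<longleftrightarrow>
     (\<forall>i<m. \<forall>t\<in>I. 0 \<le> y i t) \<and>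
     (\<forall>i<m. \<forall>s\<in>I. \<forall>t\<in>I. s \<le> t \<longrightarrow> y i s \<le> y i t) \<and>
     (\<forall>i. Suc i < m \<longrightarrow> (\<forall>s\<in>I. \<forall>t\<in>I. s \<le> t \<longrightarrow> y i t - y i s \<le> (t - s) * y (Suc i) t)) \<and>
     (\<forall>s\<in>I. \<forall>t\<in>I. s \<le> t \<longrightarrow> y (m - 1) t - y (m - 1) s \<le> h (y k t) * (Q t - Q s))"

lemma growth_chainD:
  assumes "growth_chain m k h Q I y"
  shows growth_chain_nonneg: "i < m \<Longrightarrow> t \<in> I \<Longrightarrow> 0 \<le> y i t"
    and growth_chain_mono: "i < m \<Longrightarrow> s \<in> I \<Longrightarrow> t \<in> I \<Longrightarrow> s \<le> t \<Longrightarrow> y i s \<le> y i t"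
    and growth_chain_slope:
      "Suc i < m \<Longrightarrow> s \<in> I \<Longrightarrow> t \<in> I \<Longrightarrow> s \<le> t \<Longrightarrow> y i t - y i s \<le> (t - s) * y (Suc i) t"
    and growth_chain_top:
      "s \<in> I \<Longrightarrow> t \<in> I \<Longrightarrow> s \<le> t \<Longrightarrow> y (m - 1) t - y (m - 1) s \<le> h (y k t) * (Q t - Q s)"
  using assms unfolding growth_chain_def by blast+

lemma growth_chain_subset:
  "growth_chain m k h Q I y \<Longrightarrow> J \<subseteq> I \<Longrightarrow> growth_chain m k h Q J y"
  unfolding growth_chain_def by (meson subsetD)

text \<open>
  On \<open>I \<inter> {..b}\<close> every component has the same modulus of continuity, and it depends only on
  bounds for the values at \<open>b\<close>. Equicontinuity of the Euler polygons and absolute continuity of the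
  extended solution both come from here.
\<close>

lemma growth_chain_modulus:
  assumes ch: "growth_chain m k h Q I y" and i: "i < m" and k: "k < m"
    and st: "s \<in> I" "t \<in> I" "b \<in> I" "s \<le> t" "t \<le> b"
    and B: "\<And>j. j < m \<Longrightarrow> y j b \<le> B" and H: "h (y k b) \<le> H"
    and h: "mono_on {0..} h" "0 \<le> H" and Q: "Q s \<le> Q t"
  shows "y i t - y i s \<le> B * (t - s) + H * (Q t - Q s)"
proof -
  have B0: "0 \<le> B" using growth_chain_nonneg[OF ch i st(3)] B[OF i] by linarith
  show ?thesis
  proof (cases "Suc i < m")
    case True
    have "y i t - y i s \<le> (t - s) * y (Suc i) t" by (rule growth_chain_slope[OF ch True st(1,2,4)])
    also have "\<dots> \<le> (t - s) * B"
      using growth_chain_mono[OF ch True st(2,3,5)] B[OF True] st by (intro mult_left_mono) auto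
    finally show ?thesis using h(2) Q by (simp add: mult.commute add_increasing2)
  next
    case False
    hence im: "i = m - 1" using i by simp
    have "y i t - y i s \<le> h (y k t) * (Q t - Q s)"
      unfolding im by (rule growth_chain_top[OF ch st(1,2,4)])
    also have "\<dots> \<le> H * (Q t - Q s)"
    proof (rule mult_right_mono)
      have "h (y k t) \<le> h (y k b)"
        using growth_chain_nonneg[OF ch k] growth_chain_mono[OF ch k st(2,3,5)] st
        by (intro mono_onD[OF h(1)]) auto
      thus "h (y k t) \<le> H" using H by linarith
    qed (use Q in simp)
    finally show ?thesis using B0 st by (simp add: add_increasing)
  qed
qed

lemma growth_chain_continuous_on:
  assumes ch: "growth_chain m k h Q {t0..b} y" and i: "i < m" and k: "k < m"
    and h: "mono_on {0..} h" and Q: "mono_on {t0..b} Q" "continuous_on {t0..b} Q"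
  shows "continuous_on {t0..b} (y i)"
proof (cases "t0 \<le> b")
  case False thus ?thesis by simp
next
  case True
  define B where "B = Max ((\<lambda>j. y j b) ` {..<m})"
  define H where "H = max 0 (h (y k b))"
  \<comment> \<open>a continuous function whose increments dominate those of all components\<close>
  define G where "G t = B * t + H * Q t" for t
  have B: "y j b \<le> B" if "j < m" for j unfolding B_def using that by (intro Max_ge) auto
  have *: "\<bar>y i t - y i s\<bar> \<le> \<bar>G t - G s\<bar>" if "s \<in> {t0..b}" "t \<in> {t0..b}" "s \<le> t" for s t
  proof -
    have "y i t - y i s \<le> B * (t - s) + H * (Q t - Q s)"
      using that True by (intro growth_chain_modulus[OF ch i k, of s t b] B h mono_onD[OF Q(1)]) (auto simp: H_def)
    also have "\<dots> = G t - G s" by (simp add: G_def algebra_simps)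
    finally show ?thesis using growth_chain_mono[OF ch i that] by linarith
  qed
  have **: "\<bar>y i t - y i s\<bar> \<le> \<bar>G t - G s\<bar>" if "s \<in> {t0..b}" "t \<in> {t0..b}" for s t
    using *[OF that] *[OF that(2,1)] by (cases "s \<le> t") (auto simp: abs_minus_commute)
  have "continuous_on {t0..b} G" unfolding G_def by (intro continuous_intros Q)
  thus ?thesis
    unfolding continuous_on_iff dist_real_def by (meson ** le_less_trans)
qed

section \<open>The a priori bound\<close>

lemma power_superadd:
  fixes x y :: real
  assumes "0 \<le> x" "0 \<le> y" "0 < n"
  shows "x ^ n + y ^ n \<le> (x + y) ^ n"
  using assms(3)
proof (induction n rule: nat_induct_non_zero)
  case (Suc n)
  have "x ^ Suc n + y ^ Suc n \<le> (x + y) * (x ^ n + y ^ n)"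
    using assms by (simp add: algebra_simps)
  also have "\<dots> \<le> (x + y) * (x + y) ^ n"
    using assms Suc by (intro mult_left_mono) auto
  finally show ?case by simp
qed simp

text \<open>
  If \<open>x\<close> is a length of time and \<open>root d w\<close> is measured in the same unit, then \<open>x * w\<close> has degree
  \<open>d + 1\<close>. Taking roots of order \<open>d + 1\<close> makes every term of the recursion homogeneous of degree one,
  so that the terms can be summed along the chain.
\<close>

lemma root_recursion_step:
  assumes d: "0 < d" and nn: "0 \<le> v" "0 \<le> v'" "0 \<le> w" "0 \<le> x" and le: "v' \<le> v / 2 + x * w"
  shows "root (Suc d) v' \<le> root (Suc d) (1/2) * root (Suc d) v + (x + root d w)"
proof -
  define R where "R = root (Suc d) (1/2) * root (Suc d) v + (x + root d w)"
  have nnr: "0 \<le> root (Suc d) (1/2) * root (Suc d) v" "0 \<le> root d w" using nn by (auto intro!: real_root_ge_zero)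
  have R0: "0 \<le> R" using nnr nn unfolding R_def by linarith
  have "v / 2 = (root (Suc d) (1/2) * root (Suc d) v) ^ Suc d"
    unfolding power_mult_distrib using nn by (subst (1 2) real_root_pow_pos2) auto
  moreover have "x * w \<le> (x + root d w) ^ Suc d"
  proof -
    have "x * w = x * root d w ^ d" using d nn by simp
    also have "\<dots> \<le> (x + root d w) * (x + root d w) ^ d"
      using nn nnr by (intro mult_mono power_mono) auto
    finally show ?thesis by simp
  qed
  ultimately have "v' \<le> R ^ Suc d"
    using le power_superadd[OF nnr(1), of "x + root d w" "Suc d"] nn nnr unfolding R_def by linarith
  hence "root (Suc d) v' \<le> root (Suc d) (R ^ Suc d)" by (simp del: power_Suc)
  also have "\<dots> = R" using R0 by (subst real_root_power_cancel) auto
  finally show ?thesis unfolding R_def .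
qed

text \<open>
  The shifted sum differs from the unshifted one by boundary terms only, so the factor \<open>r < 1\<close> lets
  the sum on the right be absorbed on the left.
\<close>

lemma sum_of_contracting_recursion_le:
  fixes u b :: "nat \<Rightarrow> real"
  assumes r: "0 \<le> r" "r < 1" and u: "\<And>j. j \<le> n \<Longrightarrow> 0 \<le> u j"
    and step: "\<And>j. j < n \<Longrightarrow> u (Suc j) \<le> r * u j + b j"
  shows "(\<Sum>j<n. u (Suc j)) \<le> (u 0 + (\<Sum>j<n. b j)) / (1 - r)"
proof -
  have "(\<Sum>j<n. u (Suc j)) \<le> (\<Sum>j<n. r * u j + b j)"
    by (rule sum_mono) (use step in auto)
  also have "\<dots> = r * (\<Sum>j<n. u j) + (\<Sum>j<n. b j)"
    by (simp add: sum.distrib sum_distrib_left)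
  also have "r * (\<Sum>j<n. u j) \<le> r * (u 0 + (\<Sum>j<n. u (Suc j)))"
  proof (rule mult_left_mono[OF _ r(1)])
    have "(\<Sum>j<n. u j) + u n = u 0 + (\<Sum>j<n. u (Suc j))"
      using sum.lessThan_Suc_shift[of u n] by simp
    thus "(\<Sum>j<n. u j) \<le> u 0 + (\<Sum>j<n. u (Suc j))" using u[of n] by simp
  qed
  finally have "(\<Sum>j<n. u (Suc j)) * (1 - r) \<le> r * u 0 + (\<Sum>j<n. b j)"
    by (simp add: algebra_simps)
  also have "r * u 0 \<le> u 0" using r u[of 0] by (simp add: mult_left_le_one_le)
  finally show ?thesis using r by (simp add: pos_le_divide_eq)
qed

text \<open>
  The recursion obeyed by \<open>V e j = y (m - e) t\<^sub>j / h s\<^sub>j\<close> at times \<open>t\<^sub>j\<close> between which \<open>h\<close> doubles: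
  \<open>\<Delta> j\<close> is the time elapsed in step \<open>j\<close> and \<open>\<theta> j\<close> the increment of \<open>Q\<close>. The single number \<open>K\<close>
  bounds the roots of the initial values, the total time and the total increment.
\<close>

definition halving_chain ::
    "nat \<Rightarrow> nat \<Rightarrow> real \<Rightarrow> (nat \<Rightarrow> nat \<Rightarrow> real) \<Rightarrow> (nat \<Rightarrow> real) \<Rightarrow> (nat \<Rightarrow> real) \<Rightarrow> bool" where
  "halving_chain d n K V \<Delta> \<theta> \<longleftrightarrow>
     0 \<le> K \<and> (\<forall>e\<in>{1..d}. \<forall>j\<le>n. 0 \<le> V e j) \<and> (\<forall>e\<in>{1..d}. root e (V e 0) \<le> K) \<and>
     (\<forall>j<n. 0 \<le> \<Delta> j) \<and> (\<Sum>j<n. \<Delta> j) \<le> K \<and> (\<Sum>j<n. \<theta> j) \<le> K \<and>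
     (\<forall>j<n. V 1 (Suc j) \<le> V 1 j / 2 + \<theta> j) \<and>
     (\<forall>e\<in>{1..<d}. \<forall>j<n. V (Suc e) (Suc j) \<le> V (Suc e) j / 2 + \<Delta> j * V e (Suc j))"

text \<open>
  Each order of the chain is summed in terms of the order below it. The constant depends on the
  order \<open>d\<close> alone, in particular not on the number \<open>n\<close> of steps.
\<close>

lemma halving_chain_sum_root_le:
  assumes "0 < d"
  shows "\<exists>C\<ge>0. \<forall>n K V \<Delta> \<theta>. halving_chain d n K V \<Delta> \<theta> \<longrightarrow> (\<Sum>j<n. root d (V d (Suc j))) \<le> C * K"
  using assms
proof (induction d rule: nat_induct_non_zero)
  case 1
  show ?case
  proof (intro exI[of _ 4] conjI allI impI)
    fix n K V \<Delta> \<theta>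
    assume A: "halving_chain 1 n K V \<Delta> \<theta>"
    have "(\<Sum>j<n. V 1 (Suc j)) \<le> (V 1 0 + (\<Sum>j<n. \<theta> j)) / (1 - 1/2)"
      by (rule sum_of_contracting_recursion_le) (use A in \<open>auto simp: halving_chain_def\<close>)
    also have "\<dots> \<le> 4 * K" using A by (simp add: halving_chain_def)
    finally show "(\<Sum>j<n. root 1 (V 1 (Suc j))) \<le> 4 * K" by simp
  qed simp
next
  case (Suc d)
  then obtain C where C: "0 \<le> C"
    "\<And>n K V \<Delta> \<theta>. halving_chain d n K V \<Delta> \<theta> \<Longrightarrow> (\<Sum>j<n. root d (V d (Suc j))) \<le> C * K" by blast
  \<comment> \<open>the contraction factor left over from the halving after taking roots\<close>
  define r where "r = root (Suc d) (1/2)"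
  have r: "0 \<le> r" "r < 1" unfolding r_def by auto
  show ?case
  proof (intro exI[of _ "(2 + C) / (1 - r)"] conjI allI impI)
    show "0 \<le> (2 + C) / (1 - r)" using C r by simp
    fix n K V \<Delta> \<theta>
    assume "halving_chain (Suc d) n K V \<Delta> \<theta>"
    hence A: "0 \<le> K" "\<forall>e\<in>{1..Suc d}. \<forall>j\<le>n. 0 \<le> V e j" "\<forall>e\<in>{1..Suc d}. root e (V e 0) \<le> K"
      "\<forall>j<n. 0 \<le> \<Delta> j" "(\<Sum>j<n. \<Delta> j) \<le> K" "(\<Sum>j<n. \<theta> j) \<le> K"
      "\<forall>j<n. V 1 (Suc j) \<le> V 1 j / 2 + \<theta> j"
      "\<forall>e\<in>{1..<Suc d}. \<forall>j<n. V (Suc e) (Suc j) \<le> V (Suc e) j / 2 + \<Delta> j * V e (Suc j)"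
      by (auto simp: halving_chain_def)
    have ih: "(\<Sum>j<n. root d (V d (Suc j))) \<le> C * K"
      by (rule C(2)[of n K V \<Delta> \<theta>]) (use A in \<open>auto simp: halving_chain_def\<close>)
    have "(\<Sum>j<n. root (Suc d) (V (Suc d) (Suc j)))
        \<le> (root (Suc d) (V (Suc d) 0) + (\<Sum>j<n. \<Delta> j + root d (V d (Suc j)))) / (1 - r)"
    proof (rule sum_of_contracting_recursion_le[OF r])
      show "0 \<le> root (Suc d) (V (Suc d) j)" if "j \<le> n" for j using A(2) that by auto
      fix j assume j: "j < n"
      show "root (Suc d) (V (Suc d) (Suc j)) \<le> r * root (Suc d) (V (Suc d) j) + (\<Delta> j + root d (V d (Suc j)))"
        unfolding r_def
        by (rule root_recursion_step[OF \<open>0 < d\<close>]) (use A j \<open>0 < d\<close> in auto)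
    qed
    also have "\<dots> \<le> (K + (K + C * K)) / (1 - r)"
      using A ih r by (intro divide_right_mono add_mono) (auto simp: sum.distrib)
    also have "\<dots> = (2 + C) / (1 - r) * K" by (simp add: algebra_simps add_divide_distrib)
    finally show "(\<Sum>j<n. root (Suc d) (V (Suc d) (Suc j))) \<le> (2 + C) / (1 - r) * K" .
  qed
qed

text \<open>
  The integral condition as a divergent series. The levels are chosen so that \<open>h\<close>, and not \<open>s\<close>,
  doubles. Between two consecutive levels \<open>h\<close> is comparable to its value at the upper one, so with
  \<open>p = 1 / l\<close> the integral of \<open>h powr (- p) * s powr (p - 1)\<close> over that range is at most a
  constant times the \<open>l\<close>-th root of the quotient of the upper level by its value under \<open>h\<close>.
\<close>

lemma dyadic_levels:
  fixes h :: "real \<Rightarrow> real"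
  assumes h: "mono_on {0..} h" "continuous_on {0..} h" "\<And>s. 0 < s \<Longrightarrow> 0 < h s"
    and unb: "\<And>H. \<exists>s\<ge>0. H < h s" and l: "0 < l" and s0: "1 \<le> s0"
    and div: "(\<integral>\<^sup>+ s \<in> {1..}. ennreal (h s powr (- 1 / real l) * s powr (1 / real l - 1)) \<partial>lborel) = \<infinity>"
  obtains s where "s 0 = s0" "\<And>j. s0 \<le> s j" "\<And>j. h (s j) = 2 ^ j * h s0"
    "\<And>K. \<exists>n. K < (\<Sum>j<n. root l (s (Suc j) / h (s (Suc j))))"
proof -
  have hm: "h x \<le> h y" if "0 \<le> x" "x \<le> y" for x y
    by (rule mono_onD[OF h(1)]) (use that in auto)
  have h0: "0 < h s0" using h(3) s0 by simp
  have "\<exists>x\<ge>s0. h x = 2 ^ j * h s0" for j :: nat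
  proof -
    obtain b where b: "b \<ge> 0" "2 ^ j * h s0 < h b" using unb by blast
    have "h s0 \<le> 2 ^ j * h s0" using h0 by simp
    hence "h s0 < h b" using b by linarith
    hence "s0 \<le> b" using hm[OF b(1), of s0] by linarith
    have "\<exists>x. s0 \<le> x \<and> x \<le> b \<and> h x = 2 ^ j * h s0"
      using s0 b \<open>s0 \<le> b\<close> \<open>h s0 \<le> 2 ^ j * h s0\<close>
      by (intro IVT' continuous_on_subset[OF h(2)]) auto
    thus ?thesis by blast
  qed
  then obtain s' where s': "\<And>j. s0 \<le> s' j" "\<And>j. h (s' j) = 2 ^ j * h s0" by metis
  define s where "s j = (if j = 0 then s0 else s' j)" for j
  have s: "s 0 = s0" "\<And>j. s0 \<le> s j" "\<And>j. h (s j) = 2 ^ j * h s0"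
    using s' by (auto simp: s_def)
  have s1: "1 \<le> s j" for j using s(2)[of j] s0 by simp
  have s_less: "s j < s (Suc j)" for j
  proof (rule ccontr)
    assume "\<not> s j < s (Suc j)"
    hence "h (s (Suc j)) \<le> h (s j)" using s1[of "Suc j"] by (intro hm) auto
    thus False using h0 by (simp add: s(3))
  qed
  have reach: "\<exists>n. x < s n" for x
  proof (rule ccontr)
    assume "\<not> (\<exists>n. x < s n)"
    hence le: "s n \<le> x" for n by (meson not_less)
    have "2 ^ n * h s0 \<le> h x" for n
      using hm[OF _ le, of n] s1[of n] by (simp add: s(3))
    moreover obtain n :: nat where "h x / h s0 < 2 ^ n" using real_arch_pow[of 2 "h x / h s0"] by auto
    ultimately show False using h0 by (simp add: pos_divide_less_eq) (meson not_less)
  qed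
  define p where "p = 1 / real l"
  have p: "0 < p" "p \<le> 1" using l by (auto simp: p_def)
  define A where "A j = root l (s (Suc j) / h (s (Suc j)))" for j
  have A0: "0 \<le> A j" for j using s1[of "Suc j"] h(3)[of "s (Suc j)"] unfolding A_def by (intro real_root_ge_zero) auto
  \<comment> \<open>the integrand on the \<open>j\<close>-th range with \<open>h\<close> frozen at its left end; it has an elementary primitive\<close>
  define G where "G j x = ennreal (h (s j) powr (- p) * x powr (p - 1)) * indicator {s j..s (Suc j)} x" for j x
  have G: "(\<integral>\<^sup>+ x. G j x \<partial>lborel) \<le> ennreal (2 * real l * A j)" for j
  proof -
    define c where "c = h (s j) powr (- p)"
    have "(\<integral>\<^sup>+ x. G j x \<partial>lborel)
        = ennreal (c * real l * s (Suc j) powr p - c * real l * s j powr p)"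
      unfolding G_def c_def[symmetric]
    proof (rule nn_integral_FTC_Icc)
      show "s j \<le> s (Suc j)" using s_less[of j] by simp
      fix x assume x: "x \<in> {s j..s (Suc j)}"
      show "((\<lambda>x. c * real l * x powr p) has_real_derivative c * x powr (p - 1)) (at x)"
        using x s1[of j] l by (auto intro!: derivative_eq_intros simp: p_def)
      show "0 \<le> c * x powr (p - 1)" by (simp add: c_def)
    qed simp
    also have "\<dots> \<le> ennreal (2 * real l * A j)"
    proof (rule ennreal_leI)
      have hs: "0 < h (s j)" "h (s (Suc j)) = 2 * h (s j)" using h0 by (auto simp: s(3))
      have "A j = (s (Suc j) / h (s (Suc j))) powr p"
        using l s1[of "Suc j"] hs by (simp add: A_def p_def root_powr_inverse inverse_eq_divide)
      also have "\<dots> = s (Suc j) powr p * c * 2 powr (- p)"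
        using s1[of "Suc j"] hs by (simp add: powr_divide powr_mult powr_minus c_def field_simps)
      finally have "2 * A j = (2 * 2 powr (- p)) * (s (Suc j) powr p * c)" by simp
      moreover have "(1::real) \<le> 2 * 2 powr (- p)"
        using p powr_mono[of p 1 2] by (simp add: powr_minus field_simps)
      moreover have "0 \<le> s (Suc j) powr p * c" by (simp add: c_def)
      ultimately have "s (Suc j) powr p * c \<le> 2 * A j"
        by (metis mult_right_mono mult_1)
      hence "real l * (s (Suc j) powr p * c) \<le> real l * (2 * A j)" by (intro mult_left_mono) auto
      moreover have "0 \<le> c * real l * s j powr p" by (simp add: c_def)
      ultimately show "c * real l * s (Suc j) powr p - c * real l * s j powr p \<le> 2 * real l * A j"
        by (simp add: algebra_simps)
    qed
    finally show ?thesis .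
  qed
  have "\<exists>n. K < (\<Sum>j<n. A j)" for K
  proof (rule ccontr)
    assume "\<not> (\<exists>n. K < (\<Sum>j<n. A j))"
    hence le: "(\<Sum>j<n. A j) \<le> K" for n by (meson not_less)
    define c where "c = h 1 powr (- p)"
    have "(\<integral>\<^sup>+ x \<in> {1..}. ennreal (h x powr (- 1 / real l) * x powr (1 / real l - 1)) \<partial>lborel)
       \<le> (\<integral>\<^sup>+ x. ennreal c * indicator {1..s0} x + (\<Sum>j. G j x) \<partial>lborel)"
    proof (rule nn_integral_mono)
      fix x :: real
      have "ennreal (h x powr (- p) * x powr (p - 1)) \<le> ennreal c * indicator {1..s0} x + (\<Sum>j. G j x)"
        if x: "1 \<le> x"
      proof (cases "x \<le> s0")
        case True
        have "h x powr (- p) * x powr (p - 1) \<le> c * 1"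
          unfolding c_def
        proof (rule mult_mono)
          show "h x powr (- p) \<le> h 1 powr (- p)"
            using p h(3)[of 1] hm[of 1 x] x by (intro powr_mono2') auto
          show "x powr (p - 1) \<le> 1" using powr_mono[of "p - 1" 0 x] p x by simp
        qed auto
        hence "ennreal (h x powr (- p) * x powr (p - 1)) \<le> ennreal c * indicator {1..s0} x"
          using True x by (simp add: ennreal_leI)
        thus ?thesis by (simp add: add_increasing2)
      next
        case False
        define n where "n = (LEAST n. x < s n)"
        have n: "x < s n" unfolding n_def by (rule LeastI_ex[OF reach])
        with False s(1) obtain j where j: "n = Suc j" by (cases n) auto
        have "\<not> x < s j" using not_less_Least[of j "\<lambda>n. x < s n"] j unfolding n_def by simp
        hence xj: "s j \<le> x" "x \<le> s (Suc j)" using n j by auto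
        have "h x powr (- p) * x powr (p - 1) \<le> h (s j) powr (- p) * x powr (p - 1)"
          using p h(3)[of "s j"] hm[of "s j" x] s1[of j] xj by (intro mult_right_mono powr_mono2') auto
        hence "ennreal (h x powr (- p) * x powr (p - 1)) \<le> G j x"
          using xj by (simp add: G_def ennreal_leI)
        also have "G j x = (\<Sum>i\<in>{j}. G i x)" by simp
        also have "\<dots> \<le> (\<Sum>i. G i x)" by (rule sum_le_suminf) auto
        finally show ?thesis by (simp add: add_increasing)
      qed
      thus "ennreal (h x powr (- 1 / real l) * x powr (1 / real l - 1)) * indicator {1..} x
          \<le> ennreal c * indicator {1..s0} x + (\<Sum>j. G j x)"
        by (cases "1 \<le> x") (auto simp: p_def)
    qed
    also have "\<dots> = ennreal c * ennreal (s0 - 1) + (\<Sum>j. \<integral>\<^sup>+ x. G j x \<partial>lborel)"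
    proof (subst nn_integral_add)
      show "(\<lambda>x. \<Sum>j. G j x) \<in> borel_measurable lborel" unfolding G_def by measurable
      have "(\<integral>\<^sup>+ x. (\<Sum>j. G j x) \<partial>lborel) = (\<Sum>j. \<integral>\<^sup>+ x. G j x \<partial>lborel)"
        by (rule nn_integral_suminf) (unfold G_def, measurable)
      thus "(\<integral>\<^sup>+ x. ennreal c * indicator {1..s0} x \<partial>lborel) + (\<integral>\<^sup>+ x. (\<Sum>j. G j x) \<partial>lborel)
          = ennreal c * ennreal (s0 - 1) + (\<Sum>j. \<integral>\<^sup>+ x. G j x \<partial>lborel)"
        using s0 by (simp add: nn_integral_cmult)
    qed measurable
    also have "(\<Sum>j. \<integral>\<^sup>+ x. G j x \<partial>lborel) \<le> (\<Sum>j. ennreal (2 * real l * A j))"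
      by (intro suminf_le G) auto
    also have "\<dots> \<le> ennreal (2 * real l * K)"
    proof (rule suminf_le_const)
      fix n
      have "(\<Sum>j<n. ennreal (2 * real l * A j)) = ennreal (2 * real l * (\<Sum>j<n. A j))"
        using A0 by (subst sum_ennreal) (auto simp: sum_distrib_left)
      also have "\<dots> \<le> ennreal (2 * real l * K)" using le[of n] by (intro ennreal_leI mult_left_mono) auto
      finally show "(\<Sum>j<n. ennreal (2 * real l * A j)) \<le> ennreal (2 * real l * K)" .
    qed auto
    finally have "\<infinity> \<le> ennreal c * ennreal (s0 - 1) + ennreal (2 * real l * K)"
      unfolding div by simp
    moreover have "\<dots> < \<infinity>" by (simp add: ennreal_mult_less_top)
    ultimately show False by (simp add: not_less[symmetric])
  qed
  thus thesis using that[OF s] unfolding A_def by blast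
qed

text \<open>
  If \<open>y k\<close> passed every level of a sufficiently long list of dyadic levels, the normalised values of the chain at the
  passage times would form a halving chain, whose sum of roots is at most a fixed multiple of \<open>K\<close>;
  but this sum is a partial sum of a divergent series. When \<open>h\<close> is bounded there are not enough
  levels, but then the claim is clear. The bound is uniform in \<open>y\<close>, which is
  what makes it applicable to all Euler polygons at once.
\<close>

lemma growth_chain_a_priori:
  fixes h Q :: "real \<Rightarrow> real"
  assumes k: "k < m" and c: "\<And>i. i < m \<Longrightarrow> 0 \<le> c i"
    and h: "mono_on {0..} h" "continuous_on {0..} h" "\<And>s. 0 \<le> s \<Longrightarrow> 0 \<le> h s" "\<And>s. 0 < s \<Longrightarrow> 0 < h s"
    and div: "(\<integral>\<^sup>+ s \<in> {1..}. ennreal (h s powr (- 1 / real (m - k)) * s powr (1 / real (m - k) - 1)) \<partial>lborel) = \<infinity>"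
    and Q: "mono_on {t0..t1} Q" "continuous_on {t0..t1} Q"
  obtains H where "0 \<le> H" "\<And>y t. growth_chain m k h Q {t0..t} y \<Longrightarrow> t0 \<le> t \<Longrightarrow> t \<le> t1 \<Longrightarrow>
      (\<And>i. i < m \<Longrightarrow> y i t0 \<le> c i) \<Longrightarrow> h (y k t) \<le> H"
proof (cases "\<exists>H. \<forall>s\<ge>0. h s \<le> H")
  case True
  then obtain H where "\<And>s. 0 \<le> s \<Longrightarrow> h s \<le> H" by blast
  hence H: "h s \<le> max 0 H" if "0 \<le> s" for s using that by (simp add: le_max_iff_disj)
  show thesis
  proof (rule that[of "max 0 H"])
    fix y t assume "growth_chain m k h Q {t0..t} y" "t0 \<le> t"
    thus "h (y k t) \<le> max 0 H" using growth_chain_nonneg k by (intro H) fastforce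
  qed simp
next
  case False
  define l where "l = m - k"
  have l: "0 < l" using k by (simp add: l_def)
  \<comment> \<open>at least 1, where the divergent integral starts, and not below the initial value of \<open>y k\<close>\<close>
  define s0 where "s0 = max 1 (c k)"
  obtain s where s: "s 0 = s0" "\<And>j. s0 \<le> s j" "\<And>j. h (s j) = 2 ^ j * h s0"
    "\<And>K. \<exists>n. K < (\<Sum>j<n. root l (s (Suc j) / h (s (Suc j))))"
  proof (rule dyadic_levels[OF h(1,2,4) _ l])
    show "\<exists>s\<ge>0. H < h s" for H using False by (meson not_le)
    show "1 \<le> s0" by (simp add: s0_def)
    show "(\<integral>\<^sup>+ s \<in> {1..}. ennreal (h s powr (- 1 / real l) * s powr (1 / real l - 1)) \<partial>lborel) = \<infinity>"
      unfolding l_def by (rule div)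
  qed blast+
  have h0: "0 < h s0" using h(4)[of s0] by (simp add: s0_def)
  have hpos: "0 < h (s j)" for j using h0 by (simp add: s(3))
  have sc: "c k \<le> s j" "1 \<le> s j" for j using s(2)[of j] by (auto simp: s0_def)
  have s_less: "s j < s (Suc j)" for j
  proof (rule ccontr)
    assume "\<not> s j < s (Suc j)"
    hence "h (s (Suc j)) \<le> h (s j)" using sc(2)[of "Suc j"] sc(2)[of j] by (intro mono_onD[OF h(1)]) auto
    thus False using h0 by (simp add: s(3))
  qed
  have "incseq s" by (rule incseq_SucI) (simp add: s_less less_imp_le)
  hence s_mono: "s i \<le> s j" if "i \<le> j" for i j using that by (rule incseqD)
  obtain C where C: "0 \<le> C"
    "\<And>n K V \<Delta> \<theta>. halving_chain l n K V \<Delta> \<theta> \<Longrightarrow> (\<Sum>j<n. root l (V l (Suc j))) \<le> C * K"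
    using halving_chain_sum_root_le[OF l] by blast
  define K where "K = \<bar>t1 - t0\<bar> + \<bar>Q t1 - Q t0\<bar> + (\<Sum>e\<in>{1..l}. root e (c (m - e) / h s0))"
  have root0: "0 \<le> root e (c (m - e) / h s0)" if "e \<in> {1..l}" for e
    using that k c[of "m - e"] h0 by (intro real_root_ge_zero) (auto simp: l_def)
  hence sum0: "0 \<le> (\<Sum>e\<in>{1..l}. root e (c (m - e) / h s0))" by (intro sum_nonneg) auto
  obtain n where n: "C * K < (\<Sum>j<n. root l (s (Suc j) / h (s (Suc j))))" using s(4) by blast
  show thesis
  proof (rule that[of "h (s n)"])
    show "0 \<le> h (s n)" using hpos[of n] by simp
    fix y t assume ch: "growth_chain m k h Q {t0..t} y" and t: "t0 \<le> t" "t \<le> t1"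
      and init: "\<And>i. i < m \<Longrightarrow> y i t0 \<le> c i"
    note nonneg = growth_chain_nonneg[OF ch] and mono = growth_chain_mono[OF ch]
    show "h (y k t) \<le> h (s n)"
    proof (rule ccontr)
      assume "\<not> h (y k t) \<le> h (s n)"
      have reach: "s n < y k t"
      proof (rule ccontr)
        assume "\<not> s n < y k t"
        hence "h (y k t) \<le> h (s n)"
          using nonneg[OF k, of t] t sc(2)[of n] by (intro mono_onD[OF h(1)]) auto
        with \<open>\<not> h (y k t) \<le> h (s n)\<close> show False by simp
      qed
      have Qt: "mono_on {t0..t} Q" "continuous_on {t0..t} Q"
        using Q t by (auto intro: mono_on_subset continuous_on_subset)
      have cont: "continuous_on {t0..t} (y k)"
        by (rule growth_chain_continuous_on[OF ch k k h(1) Qt])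
      have "\<exists>x. t0 \<le> x \<and> x \<le> t \<and> y k x = s j" if "j \<le> n" for j
        using t reach s_mono[OF that] init[OF k] sc(1)[of j] cont by (intro IVT') auto
      then obtain \<sigma> where \<sigma>: "\<And>j. j \<le> n \<Longrightarrow> t0 \<le> \<sigma> j \<and> \<sigma> j \<le> t \<and> y k (\<sigma> j) = s j" by metis
      \<comment> \<open>the chain starts at \<open>t0\<close>, where \<open>y k\<close> may lie below \<open>s 0\<close>; the levels count from index 1 on\<close>
      define \<tau> where "\<tau> j = (if j = 0 then t0 else \<sigma> j)" for j
      have \<tau>_in: "\<tau> j \<in> {t0..t}" if "j \<le> n" for j using \<sigma>[OF that] t by (auto simp: \<tau>_def)
      have \<tau>_level: "y k (\<tau> (Suc j)) = s (Suc j)" if "j < n" for j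
        using \<sigma>[of "Suc j"] that by (auto simp: \<tau>_def)
      have \<tau>_step: "\<tau> j \<le> \<tau> (Suc j)" if "j < n" for j
      proof (rule ccontr)
        assume neg: "\<not> \<tau> j \<le> \<tau> (Suc j)"
        with \<tau>_in[of "Suc j"] that have j: "j \<noteq> 0" by (cases "j = 0") (auto simp: \<tau>_def)
        have "y k (\<tau> (Suc j)) \<le> y k (\<tau> j)"
          using neg that \<tau>_in[of j] \<tau>_in[of "Suc j"] by (intro mono k) auto
        thus False using \<tau>_level[OF that] \<sigma>[of j] j that s_less[of j] by (simp add: \<tau>_def)
      qed
      define V where "V e j = y (m - e) (\<tau> j) / h (s j)" for e j
      have half: "x / h (s (Suc j)) = (x / h (s j)) / 2" for x j by (simp add: s(3))
      have "(\<Sum>j<n. root l (V l (Suc j))) \<le> C * K"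
      proof (rule C(2)[of n K V "\<lambda>j. \<tau> (Suc j) - \<tau> j" "\<lambda>j. Q (\<tau> (Suc j)) - Q (\<tau> j)"],
          unfold halving_chain_def, intro conjI)
        show "0 \<le> K" using sum0 by (simp add: K_def)
        show "\<forall>e\<in>{1..l}. \<forall>j\<le>n. 0 \<le> V e j"
        proof (intro ballI allI impI)
          fix e j assume e: "e \<in> {1..l}" and j: "j \<le> n"
          have "0 \<le> y (m - e) (\<tau> j)" using e k \<tau>_in[OF j] by (intro nonneg) (auto simp: l_def)
          thus "0 \<le> V e j" using hpos[of j] by (simp add: V_def)
        qed
        show "\<forall>e\<in>{1..l}. root e (V e 0) \<le> K"
        proof
          fix e assume e: "e \<in> {1..l}"
          have "root e (V e 0) \<le> root e (c (m - e) / h s0)"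
            using e init[of "m - e"] k h0
            by (intro real_root_le_mono) (auto simp: V_def \<tau>_def s(1) l_def intro!: divide_right_mono)
          also have "\<dots> \<le> (\<Sum>e\<in>{1..l}. root e (c (m - e) / h s0))"
            using e root0 by (intro member_le_sum) auto
          finally show "root e (V e 0) \<le> K" by (simp add: K_def)
        qed
        show "\<forall>j<n. 0 \<le> \<tau> (Suc j) - \<tau> j" using \<tau>_step by simp
        have "(\<Sum>j<n. \<tau> (Suc j) - \<tau> j) = \<tau> n - t0"
          using sum_lessThan_telescope[of \<tau> n] by (simp add: \<tau>_def)
        also have "\<dots> \<le> t1 - t0" using \<tau>_in[of n] t by simp
        also have "\<dots> \<le> K" using sum0 unfolding K_def by linarith
        finally show "(\<Sum>j<n. \<tau> (Suc j) - \<tau> j) \<le> K" .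
        have "(\<Sum>j<n. Q (\<tau> (Suc j)) - Q (\<tau> j)) = Q (\<tau> n) - Q t0"
          using sum_lessThan_telescope[of "\<lambda>j. Q (\<tau> j)" n] by (simp add: \<tau>_def)
        also have "\<dots> \<le> Q t1 - Q t0"
          using \<tau>_in[of n] t mono_onD[OF Q(1), of "\<tau> n" t1] by simp
        also have "\<dots> \<le> K" using sum0 by (simp add: K_def)
        finally show "(\<Sum>j<n. Q (\<tau> (Suc j)) - Q (\<tau> j)) \<le> K" .
        show "\<forall>j<n. V 1 (Suc j) \<le> V 1 j / 2 + (Q (\<tau> (Suc j)) - Q (\<tau> j))"
        proof (intro allI impI)
          fix j assume j: "j < n"
          have "y (m - 1) (\<tau> (Suc j)) - y (m - 1) (\<tau> j) \<le> h (s (Suc j)) * (Q (\<tau> (Suc j)) - Q (\<tau> j))"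
            using growth_chain_top[OF ch \<tau>_in \<tau>_in \<tau>_step[OF j]] j by (simp add: \<tau>_level)
          hence "y (m - 1) (\<tau> (Suc j)) / h (s (Suc j)) \<le>
              (y (m - 1) (\<tau> j) + h (s (Suc j)) * (Q (\<tau> (Suc j)) - Q (\<tau> j))) / h (s (Suc j))"
            using hpos[of "Suc j"] by (intro divide_right_mono) auto
          also have "\<dots> = y (m - 1) (\<tau> j) / h (s (Suc j)) + (Q (\<tau> (Suc j)) - Q (\<tau> j))"
            using hpos[of "Suc j"] by (simp add: add_divide_distrib)
          also have "\<dots> = V 1 j / 2 + (Q (\<tau> (Suc j)) - Q (\<tau> j))"
            by (simp only: V_def half)
          finally show "V 1 (Suc j) \<le> V 1 j / 2 + (Q (\<tau> (Suc j)) - Q (\<tau> j))" by (simp add: V_def)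
        qed
        show "\<forall>e\<in>{1..<l}. \<forall>j<n. V (Suc e) (Suc j) \<le> V (Suc e) j / 2 + (\<tau> (Suc j) - \<tau> j) * V e (Suc j)"
        proof (intro ballI allI impI)
          fix e j assume e: "e \<in> {1..<l}" and j: "j < n"
          have me: "Suc (m - Suc e) = m - e" "m - e < m" using e by (auto simp: l_def)
          have "y (m - Suc e) (\<tau> (Suc j)) - y (m - Suc e) (\<tau> j) \<le> (\<tau> (Suc j) - \<tau> j) * y (m - e) (\<tau> (Suc j))"
            using growth_chain_slope[OF ch _ \<tau>_in \<tau>_in \<tau>_step[OF j], of "m - Suc e"] j me by simp
          hence "y (m - Suc e) (\<tau> (Suc j)) / h (s (Suc j)) \<le>
              (y (m - Suc e) (\<tau> j) + (\<tau> (Suc j) - \<tau> j) * y (m - e) (\<tau> (Suc j))) / h (s (Suc j))"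
            using hpos[of "Suc j"] by (intro divide_right_mono) auto
          thus "V (Suc e) (Suc j) \<le> V (Suc e) j / 2 + (\<tau> (Suc j) - \<tau> j) * V e (Suc j)"
            unfolding add_divide_distrib half[of "y (m - Suc e) (\<tau> j)"] by (simp add: V_def)
        qed
      qed
      also have "(\<Sum>j<n. root l (V l (Suc j))) = (\<Sum>j<n. root l (s (Suc j) / h (s (Suc j))))"
        using k by (intro sum.cong) (auto simp: V_def \<tau>_level l_def)
      finally show False using n by simp
    qed
  qed
qed

text \<open>
  A bound on \<open>h (y k t)\<close> bounds the top component, because \<open>Q\<close> is bounded, and each component
  bounds the one below it over a bounded time.
\<close>

lemma growth_chain_a_priori_all:
  fixes h Q :: "real \<Rightarrow> real"
  assumes k: "k < m" and c: "\<And>i. i < m \<Longrightarrow> 0 \<le> c i"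
    and h: "mono_on {0..} h" "continuous_on {0..} h" "\<And>s. 0 \<le> s \<Longrightarrow> 0 \<le> h s" "\<And>s. 0 < s \<Longrightarrow> 0 < h s"
    and div: "(\<integral>\<^sup>+ s \<in> {1..}. ennreal (h s powr (- 1 / real (m - k)) * s powr (1 / real (m - k) - 1)) \<partial>lborel) = \<infinity>"
    and Q: "mono_on {t0..t1} Q" "continuous_on {t0..t1} Q"
  obtains B where "0 \<le> B" "\<And>y t i. growth_chain m k h Q {t0..t} y \<Longrightarrow> t0 \<le> t \<Longrightarrow> t \<le> t1 \<Longrightarrow>
      (\<And>i. i < m \<Longrightarrow> y i t0 \<le> c i) \<Longrightarrow> i < m \<Longrightarrow> y i t \<le> B"
proof -
  define adm where "adm y t \<longleftrightarrow> growth_chain m k h Q {t0..t} y \<and> t0 \<le> t \<and> t \<le> t1 \<and> (\<forall>i<m. y i t0 \<le> c i)" for y t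
  obtain H where H: "0 \<le> H" "\<And>y t. adm y t \<Longrightarrow> h (y k t) \<le> H"
    by (rule growth_chain_a_priori[OF k c h div Q]) (auto simp: adm_def)
  have "\<exists>B. \<forall>y t. adm y t \<longrightarrow> y (m - Suc d) t \<le> B" if "d < m" for d
    using that
  proof (induction d)
    case 0
    have "y (m - 1) t \<le> c (m - 1) + H * (Q t1 - Q t0)" if a: "adm y t" for y t
    proof -
      have t: "t0 \<le> t" "t \<le> t1" and ch: "growth_chain m k h Q {t0..t} y"
        and i: "y (m - 1) t0 \<le> c (m - 1)" using a 0 by (auto simp: adm_def)
      have q: "Q t0 \<le> Q t" "Q t \<le> Q t1" using t by (auto intro!: mono_onD[OF Q(1)])
      have "y (m - 1) t - y (m - 1) t0 \<le> h (y k t) * (Q t - Q t0)"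
        using t by (intro growth_chain_top[OF ch]) auto
      also have "\<dots> \<le> H * (Q t1 - Q t0)"
        using H(1) H(2)[OF a] q by (intro mult_mono) auto
      finally show ?thesis using i by simp
    qed
    thus ?case by auto
  next
    case (Suc d)
    then obtain B where B: "\<And>y t. adm y t \<Longrightarrow> y (m - Suc d) t \<le> B" by (meson Suc_lessD)
    have md: "Suc (m - Suc (Suc d)) = m - Suc d" "m - Suc d < m" using Suc.prems by auto
    have "y (m - Suc (Suc d)) t \<le> c (m - Suc (Suc d)) + (t1 - t0) * \<bar>B\<bar>" if a: "adm y t" for y t
    proof -
      have t: "t0 \<le> t" "t \<le> t1" and ch: "growth_chain m k h Q {t0..t} y"
        and i: "y (m - Suc (Suc d)) t0 \<le> c (m - Suc (Suc d))" using a Suc.prems by (auto simp: adm_def)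
      have "y (m - Suc (Suc d)) t - y (m - Suc (Suc d)) t0 \<le> (t - t0) * y (m - Suc d) t"
        using growth_chain_slope[OF ch, of "m - Suc (Suc d)" t0 t] md t by auto
      also have "\<dots> \<le> (t1 - t0) * \<bar>B\<bar>"
        using B[OF a] t growth_chain_nonneg[OF ch md(2), of t] by (intro mult_mono) auto
      finally show ?thesis using i by simp
    qed
    thus ?case by blast
  qed
  hence "\<forall>i\<in>{..<m}. \<exists>B. \<forall>y t. adm y t \<longrightarrow> y i t \<le> B"
    by (metis Suc_diff_Suc diff_diff_cancel diff_less lessThan_iff less_imp_le_nat zero_less_Suc diff_Suc_less less_nat_zero_code neq0_conv Suc_leI)
  then obtain B where B: "\<forall>i\<in>{..<m}. \<forall>y t. adm y t \<longrightarrow> y i t \<le> B i" by metis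
  show thesis
  proof (rule that[of "\<Sum>i<m. \<bar>B i\<bar>"])
    fix y t i assume "growth_chain m k h Q {t0..t} y" "t0 \<le> t" "t \<le> t1" "\<And>i. i < m \<Longrightarrow> y i t0 \<le> c i" and i: "i < m"
    hence "y i t \<le> \<bar>B i\<bar>" using B unfolding adm_def by force
    also have "\<dots> \<le> (\<Sum>i<m. \<bar>B i\<bar>)" using i by (intro member_le_sum) auto
    finally show "y i t \<le> (\<Sum>i<m. \<bar>B i\<bar>)" .
  qed (simp add: sum_nonneg)
qed

section \<open>Global existence by Euler polygons\<close>

text \<open>
  A diagonal subsequence converges at all rational times, and equicontinuity carries the convergence
  to the remaining ones. Pointwise convergence on the whole half-line is the mode of convergence
  that dominated convergence takes as its input.
\<close>

lemma equicontinuous_pointwise_subsequence: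
  fixes Y :: "nat \<Rightarrow> nat \<Rightarrow> real \<Rightarrow> real"
  assumes bound: "\<And>t. t0 \<le> t \<Longrightarrow> \<exists>B. \<forall>n i. \<bar>Y n i t\<bar> \<le> B"
    and equi: "\<And>b. t0 \<le> b \<Longrightarrow> \<exists>G. continuous_on {t0..b} G \<and>
      (\<forall>n i. \<forall>s\<in>{t0..b}. \<forall>t\<in>{t0..b}. \<bar>Y n i t - Y n i s\<bar> \<le> \<bar>G t - G s\<bar>)"
  obtains r where "strict_mono (r :: nat \<Rightarrow> nat)" "\<And>i t. t0 \<le> t \<Longrightarrow> \<exists>L. (\<lambda>n. Y (r n) i t) \<longlonglongrightarrow> L"
proof -
  obtain B where B: "\<And>t n i. t0 \<le> t \<Longrightarrow> \<bar>Y n i t\<bar> \<le> B t" using bound by metis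
  have B0: "0 \<le> B t" if "t0 \<le> t" for t using B[OF that, of 0 0] by linarith
  \<comment> \<open>the values are divided by \<open>1 + B x\<close> to make them bounded uniformly in \<open>x\<close>\<close>
  define S where "S = (UNIV :: nat set) \<times> (\<rat> \<inter> {t0..})"
  have "countable S" unfolding S_def by (intro countable_SIGMA countable_Int1 countable_rat) simp
  moreover have "norm ((\<lambda>(i, x). Y n i x / (1 + B x)) z) \<le> 1" if "z \<in> S" for n z
    using that B[of "snd z" n "fst z"] by (auto simp: S_def case_prod_unfold abs_le_iff field_simps)
  ultimately obtain r where r: "strict_mono (r :: nat \<Rightarrow> nat)"
    "\<And>z. z \<in> S \<Longrightarrow> \<exists>l. (\<lambda>n. (\<lambda>(i, x). Y (r n) i x / (1 + B x)) z) \<longlonglongrightarrow> l"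
    by (rule function_convergent_subsequence[of S "\<lambda>n (i, x). Y n i x / (1 + B x)" 1]) blast+
  have rat: "Cauchy (\<lambda>n. Y (r n) i x)" if x: "x \<in> \<rat>" "t0 \<le> x" for i x
  proof -
    obtain l where "(\<lambda>n. Y (r n) i x / (1 + B x)) \<longlonglongrightarrow> l"
      using r(2)[of "(i, x)"] x by (auto simp: S_def)
    hence "(\<lambda>n. (1 + B x) * (Y (r n) i x / (1 + B x))) \<longlonglongrightarrow> (1 + B x) * l" by (intro tendsto_intros)
    moreover have "1 + B x \<noteq> 0" using B0[OF x(2)] by linarith
    ultimately show ?thesis by (simp add: LIMSEQ_imp_Cauchy)
  qed
  have "Cauchy (\<lambda>n. Y (r n) i t)" if t: "t0 \<le> t" for i t
  proof (rule metric_CauchyI)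
    fix e :: real assume e: "0 < e"
    obtain G where G: "continuous_on {t0..t + 1} G"
      "\<And>n i u v. u \<in> {t0..t+1} \<Longrightarrow> v \<in> {t0..t+1} \<Longrightarrow> \<bar>Y n i v - Y n i u\<bar> \<le> \<bar>G v - G u\<bar>"
      using equi[of "t + 1"] t by auto
    obtain d where d: "d > 0" "\<And>x. x \<in> {t0..t+1} \<Longrightarrow> dist x t < d \<Longrightarrow> dist (G x) (G t) < e / 3"
      using G(1)[unfolded continuous_on_iff, rule_format, of t "e/3"] t e by auto
    obtain x where x: "x \<in> \<rat>" "t < x" "x < t + min d 1"
      using Rats_dense_in_real[of t "t + min d 1"] d(1) by auto
    have xin: "x \<in> {t0..t+1}" "t \<in> {t0..t+1}" using x t by auto
    have "dist (G x) (G t) < e/3" using d(2)[OF xin(1)] x by (simp add: dist_real_def)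
    hence near: "\<bar>Y n i x - Y n i t\<bar> < e / 3" for n
      using G(2)[OF xin(2,1), of n i] by (simp add: dist_real_def)
    obtain N where N: "\<And>m n. m \<ge> N \<Longrightarrow> n \<ge> N \<Longrightarrow> \<bar>Y (r m) i x - Y (r n) i x\<bar> < e / 3"
      using metric_CauchyD[OF rat[OF x(1), of i], of "e / 3"] x t e unfolding dist_real_def
      by (metis atLeastAtMost_iff divide_pos_pos xin(1) zero_less_numeral)
    show "\<exists>N. \<forall>m\<ge>N. \<forall>n\<ge>N. dist (Y (r m) i t) (Y (r n) i t) < e"
    proof (intro exI[of _ N] allI impI)
      fix m n assume mn: "m \<ge> N" "n \<ge> N"
      show "dist (Y (r m) i t) (Y (r n) i t) < e"
        using N[OF mn] near[of "r m"] near[of "r n"] unfolding dist_real_def by linarith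
    qed
  qed
  hence "\<exists>L. (\<lambda>n. Y (r n) i t) \<longlonglongrightarrow> L" if "t0 \<le> t" for i t
    using that by (simp add: Cauchy_convergent_iff convergent_def)
  thus thesis by (rule that[OF r(1)])
qed

text \<open>
  The nonnegative part of \<open>Euclidean_space m\<close>, in the same encoding of vectors as sequences that
  vanish from index \<open>m\<close> on.
\<close>

definition orthant :: "nat \<Rightarrow> (nat \<Rightarrow> real) set" where
  "orthant m = {x. (\<forall>i. 0 \<le> x i) \<and> (\<forall>i\<ge>m. x i = 0)}"

text \<open>
  The initial value problem at time \<open>t0\<close> with data \<open>c\<close>. Since \<open>f\<close> and \<open>c\<close> are nonnegative, the
  approximations stay in the orthant, and the local integrable majorant of \<open>f\<close> there is
  \<open>q t * h (x k)\<close>. The assumptions are made for every \<open>t\<close> rather than for almost every \<open>t\<close>; this costs a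
  change of \<open>f\<close> on a null set.
\<close>

locale dominated_caratheodory =
  fixes m k :: nat and f :: "real \<Rightarrow> (nat \<Rightarrow> real) \<Rightarrow> real" and q h Q :: "real \<Rightarrow> real"
    and t0 :: real and c :: "nat \<Rightarrow> real"
  assumes km: "k < m"
    and f_integrable: "\<And>x b. x \<in> orthant m \<Longrightarrow> (\<lambda>t. f t x) integrable_on {t0..b}"
    and f_nonneg: "\<And>t x. t0 \<le> t \<Longrightarrow> x \<in> orthant m \<Longrightarrow> 0 \<le> f t x"
    and f_le: "\<And>t x. t0 \<le> t \<Longrightarrow> x \<in> orthant m \<Longrightarrow> f t x \<le> q t * h (x k)"
    and f_continuous: "\<And>t X x. t0 \<le> t \<Longrightarrow> (\<And>n. X n \<in> orthant m) \<Longrightarrow> x \<in> orthant m \<Longrightarrow>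
        (\<And>i. (\<lambda>n. X n i) \<longlonglongrightarrow> x i) \<Longrightarrow> (\<lambda>n. f t (X n)) \<longlonglongrightarrow> f t x"
    and q_integrable: "\<And>b. q integrable_on {t0..b}"
    and q_nonneg: "\<And>t. t0 \<le> t \<Longrightarrow> 0 \<le> q t"
    and Q: "\<And>s t. t0 \<le> s \<Longrightarrow> s \<le> t \<Longrightarrow> Q t - Q s = integral {s..t} q"
    and h: "mono_on {0..} h" "continuous_on {0..} h" "\<And>s. 0 \<le> s \<Longrightarrow> 0 \<le> h s" "\<And>s. 0 < s \<Longrightarrow> 0 < h s"
    and divergent: "(\<integral>\<^sup>+ s \<in> {1..}.
        ennreal (h s powr (- 1 / real (m - k)) * s powr (1 / real (m - k) - 1)) \<partial>lborel) = \<infinity>"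
    and c_orthant: "c \<in> orthant m"
begin

lemma Q_mono: "mono_on {t0..} Q"
proof (rule mono_onI)
  fix s t assume "s \<in> {t0..}" "t \<in> {t0..}" "s \<le> t"
  hence "0 \<le> integral {s..t} q" by (intro integral_nonneg integrable_on_subinterval[OF q_integrable[of t]] q_nonneg) auto
  thus "Q s \<le> Q t" using Q[of s t] \<open>s \<in> {t0..}\<close> \<open>s \<le> t\<close> by simp
qed

lemma Q_continuous: "continuous_on {t0..b} Q"
proof -
  have "continuous_on {t0..b} (\<lambda>t. Q t0 + integral {t0..t} q)"
    by (intro continuous_on_add continuous_on_const indefinite_integral_continuous_1 q_integrable)
  thus ?thesis by (rule continuous_on_eq) (simp add: Q[OF order_refl, symmetric])
qed

text \<open>
  The equation of order \<open>m\<close> as a first-order system. All components are treated alike, so the Euler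
  polygon is linear on each cell except in component \<open>m - 1\<close>.
\<close>

definition rhs :: "real \<Rightarrow> (nat \<Rightarrow> real) \<Rightarrow> nat \<Rightarrow> real" where
  "rhs s x i = (if Suc i < m then x (Suc i) else if Suc i = m then f s x else 0)"

lemma rhs_nonneg: "t0 \<le> s \<Longrightarrow> x \<in> orthant m \<Longrightarrow> 0 \<le> rhs s x i"
  using f_nonneg by (auto simp: rhs_def orthant_def)

lemma rhs_integrable: "x \<in> orthant m \<Longrightarrow> t0 \<le> a \<Longrightarrow> (\<lambda>s. rhs s x i) integrable_on {a..b}"
  using integrable_on_subinterval[OF f_integrable[of x b], of a b]
  by (cases "Suc i < m"; cases "Suc i = m") (auto simp: rhs_def)

text \<open>
  The state at time \<open>t0 + j * \<delta>\<close>; the second argument of the right-hand side is frozen at the state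
  in which the cell was entered.
\<close>

primrec node :: "real \<Rightarrow> nat \<Rightarrow> nat \<Rightarrow> real" where
  "node \<delta> 0 = c"
| "node \<delta> (Suc j) = (\<lambda>i. node \<delta> j i + integral {t0 + real j * \<delta>..t0 + real (Suc j) * \<delta>} (\<lambda>s. rhs s (node \<delta> j) i))"

definition cell :: "real \<Rightarrow> real \<Rightarrow> nat" where
  "cell \<delta> s = nat \<lfloor>(s - t0) / \<delta>\<rfloor>"

definition euler :: "real \<Rightarrow> nat \<Rightarrow> real \<Rightarrow> real" where
  "euler \<delta> i t = c i + integral {t0..t} (\<lambda>s. rhs s (node \<delta> (cell \<delta> s)) i)"

lemma node_orthant:
  assumes "0 < \<delta>" shows "node \<delta> j \<in> orthant m"
proof (induction j)
  case 0 show ?case using c_orthant by simp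
next
  case (Suc j)
  have "0 \<le> integral {t0 + real j * \<delta>..t0 + real (Suc j) * \<delta>} (\<lambda>s. rhs s (node \<delta> j) i)" for i
    using assms by (intro integral_nonneg rhs_integrable Suc rhs_nonneg) (auto intro: order_trans[of _ "t0 + real j * \<delta>"])
  moreover have "rhs s x i = 0" if "m \<le> i" for s x i using that by (simp add: rhs_def)
  ultimately show ?case using Suc by (simp add: orthant_def)
qed

lemma cell_eq:
  assumes "0 < \<delta>" "t0 + real j * \<delta> \<le> s" "s < t0 + real (Suc j) * \<delta>"
  shows "cell \<delta> s = j"
proof -
  have "\<lfloor>(s - t0) / \<delta>\<rfloor> = int j"
    using assms by (intro floor_unique) (auto simp: field_simps)
  thus ?thesis by (simp add: cell_def)
qed

lemma cell_bounds:
  assumes "0 < \<delta>" "t0 \<le> s"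
  shows "t0 + real (cell \<delta> s) * \<delta> \<le> s" "s < t0 + real (cell \<delta> s) * \<delta> + \<delta>"
proof -
  have "0 \<le> (s - t0) / \<delta>" using assms by simp
  hence *: "real (cell \<delta> s) = of_int \<lfloor>(s - t0) / \<delta>\<rfloor>" by (simp add: cell_def)
  have "real (cell \<delta> s) \<le> (s - t0) / \<delta>" "(s - t0) / \<delta> < real (cell \<delta> s) + 1"
    unfolding * by linarith+
  thus "t0 + real (cell \<delta> s) * \<delta> \<le> s" "s < t0 + real (cell \<delta> s) * \<delta> + \<delta>"
    using assms by (auto simp: field_simps)
qed

lemma euler_cell_integral:
  assumes "0 < \<delta>"
  shows "((\<lambda>s. rhs s (node \<delta> (cell \<delta> s)) i) has_integral (node \<delta> (Suc j) i - node \<delta> j i))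
     {t0 + real j * \<delta>..t0 + real (Suc j) * \<delta>}"
proof -
  have t0: "t0 \<le> t0 + real j * \<delta>" using assms by simp
  have "((\<lambda>s. rhs s (node \<delta> j) i) has_integral (node \<delta> (Suc j) i - node \<delta> j i))
     {t0 + real j * \<delta>..t0 + real (Suc j) * \<delta>}"
    using rhs_integrable[OF node_orthant[OF assms] t0, of j i "t0 + real (Suc j) * \<delta>"]
    by (simp add: integrable_integral del: of_nat_Suc)
  thus ?thesis
    by (rule has_integral_spike_finite[of "{t0 + real (Suc j) * \<delta>}", rotated -1])
      (use cell_eq[OF assms, of j] in \<open>auto simp del: of_nat_Suc\<close>)
qed

lemma euler_has_integral_node:
  assumes "0 < \<delta>"
  shows "((\<lambda>s. rhs s (node \<delta> (cell \<delta> s)) i) has_integral (node \<delta> j i - c i)) {t0..t0 + real j * \<delta>}"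
proof (induction j)
  case 0 show ?case using has_integral_refl[of "\<lambda>s. rhs s (node \<delta> (cell \<delta> s)) i" t0] by simp
next
  case (Suc j)
  have "((\<lambda>s. rhs s (node \<delta> (cell \<delta> s)) i) has_integral
      (node \<delta> j i - c i) + (node \<delta> (Suc j) i - node \<delta> j i)) {t0..t0 + real (Suc j) * \<delta>}"
    by (rule has_integral_combine[OF _ _ Suc euler_cell_integral[OF assms]])
      (use assms in \<open>auto intro!: mult_right_mono\<close>)
  moreover have "(node \<delta> j i - c i) + (node \<delta> (Suc j) i - node \<delta> j i) = node \<delta> (Suc j) i - c i" by simp
  ultimately show ?case by (simp only:)
qed

lemma euler_at_node: "0 < \<delta> \<Longrightarrow> euler \<delta> i (t0 + real j * \<delta>) = node \<delta> j i"
  using euler_has_integral_node[of \<delta> i j] by (simp add: euler_def integral_unique)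

lemma euler_rhs_integrable:
  assumes "0 < \<delta>" "t0 \<le> a"
  shows "(\<lambda>s. rhs s (node \<delta> (cell \<delta> s)) i) integrable_on {a..b}"
proof -
  obtain j :: nat where "(b - t0) / \<delta> \<le> real j" using real_arch_simple by blast
  hence "b \<le> t0 + real j * \<delta>" using assms by (simp add: field_simps)
  thus ?thesis
    using assms by (intro integrable_on_subinterval[OF has_integral_integrable[OF euler_has_integral_node[OF assms(1), of i j]]]) auto
qed

lemma euler_diff:
  assumes "0 < \<delta>" "t0 \<le> s" "s \<le> t"
  shows "euler \<delta> i t - euler \<delta> i s = integral {s..t} (\<lambda>s. rhs s (node \<delta> (cell \<delta> s)) i)"
  using Henstock_Kurzweil_Integration.integral_combine[OF assms(2,3) euler_rhs_integrable[OF assms(1) order_refl]]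
  by (simp add: euler_def algebra_simps)

lemma euler_mono:
  assumes "0 < \<delta>" "t0 \<le> s" "s \<le> t"
  shows "euler \<delta> i s \<le> euler \<delta> i t"
proof -
  have "0 \<le> integral {s..t} (\<lambda>s. rhs s (node \<delta> (cell \<delta> s)) i)"
    using assms by (intro integral_nonneg euler_rhs_integrable rhs_nonneg node_orthant) auto
  thus ?thesis using euler_diff[OF assms, of i] by simp
qed

lemma euler_start: "euler \<delta> i t0 = c i"
  by (simp add: euler_def)

lemma euler_orthant: "0 < \<delta> \<Longrightarrow> t0 \<le> t \<Longrightarrow> (\<lambda>i. euler \<delta> i t) \<in> orthant m"
proof -
  assume a: "0 < \<delta>" "t0 \<le> t"
  have "0 \<le> euler \<delta> i t" for i
    using euler_mono[OF a(1) order_refl a(2), of i] c_orthant by (simp add: euler_start orthant_def order_trans[of 0 "c i"])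
  moreover have "euler \<delta> i t = 0" if "m \<le> i" for i
    using that c_orthant by (simp add: euler_def rhs_def orthant_def)
  ultimately show ?thesis by (simp add: orthant_def)
qed

text \<open>
  The frozen state lies in the past and the polygon is nondecreasing.
\<close>

lemma node_le_euler:
  assumes "0 < \<delta>" "t0 \<le> s" "s \<le> t"
  shows "node \<delta> (cell \<delta> s) i \<le> euler \<delta> i t"
proof -
  have "node \<delta> (cell \<delta> s) i = euler \<delta> i (t0 + real (cell \<delta> s) * \<delta>)" using euler_at_node assms by simp
  also have "\<dots> \<le> euler \<delta> i t"
    using assms cell_bounds[OF assms(1,2)] by (intro euler_mono) auto
  finally show ?thesis .
qed

text \<open>
  Freezing the state at an earlier time can only lower it. As \<open>h\<close> is nondecreasing, the bound
  \<open>q u * h (x k)\<close> at the frozen state is at most the bound at the current state, so the polygon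
  satisfies the very inequalities of a solution.
\<close>

lemma euler_growth_chain:
  assumes \<delta>: "0 < \<delta>"
  shows "growth_chain m k h Q {t0..} (euler \<delta>)"
  unfolding growth_chain_def
proof (intro conjI allI ballI impI)
  show "0 \<le> euler \<delta> i t" if "t \<in> {t0..}" for i t
    using euler_orthant[OF \<delta>, of t] that by (simp add: orthant_def)
  show "euler \<delta> i s \<le> euler \<delta> i t" if "s \<in> {t0..}" "s \<le> t" for i s t
    using that by (intro euler_mono \<delta>) auto
  show "euler \<delta> i t - euler \<delta> i s \<le> (t - s) * euler \<delta> (Suc i) t"
    if i: "Suc i < m" and s: "s \<in> {t0..}" "s \<le> t" for i s t
  proof -
    have "euler \<delta> i t - euler \<delta> i s = integral {s..t} (\<lambda>u. rhs u (node \<delta> (cell \<delta> u)) i)"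
      using s by (intro euler_diff \<delta>) auto
    also have "\<dots> \<le> integral {s..t} (\<lambda>_. euler \<delta> (Suc i) t)"
    proof (rule integral_le)
      show "(\<lambda>u. rhs u (node \<delta> (cell \<delta> u)) i) integrable_on {s..t}"
        using s by (intro euler_rhs_integrable \<delta>) auto
    qed (use s i node_le_euler[OF \<delta>] in \<open>auto simp: rhs_def\<close>)
    finally have "euler \<delta> i t - euler \<delta> i s \<le> integral {s..t} (\<lambda>_. euler \<delta> (Suc i) t)" .
    thus ?thesis using s by simp
  qed
  show "euler \<delta> (m - 1) t - euler \<delta> (m - 1) s \<le> h (euler \<delta> k t) * (Q t - Q s)"
    if s: "s \<in> {t0..}" "s \<le> t" for s t
  proof -
    have qi: "q integrable_on {s..t}" using s by (intro integrable_on_subinterval[OF q_integrable[of t]]) auto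
    have "euler \<delta> (m - 1) t - euler \<delta> (m - 1) s = integral {s..t} (\<lambda>u. rhs u (node \<delta> (cell \<delta> u)) (m - 1))"
      using s by (intro euler_diff \<delta>) auto
    also have "\<dots> \<le> integral {s..t} (\<lambda>u. q u * h (euler \<delta> k t))"
    proof (rule integral_le)
      show "(\<lambda>u. rhs u (node \<delta> (cell \<delta> u)) (m - 1)) integrable_on {s..t}"
        using s by (intro euler_rhs_integrable \<delta>) auto
      show "(\<lambda>u. q u * h (euler \<delta> k t)) integrable_on {s..t}"
        using qi by (rule integrable_on_mult_left)
      fix u assume u: "u \<in> {s..t}"
      have nk: "0 \<le> node \<delta> (cell \<delta> u) k" using node_orthant[OF \<delta>] by (simp add: orthant_def)
      have "rhs u (node \<delta> (cell \<delta> u)) (m - 1) \<le> q u * h (node \<delta> (cell \<delta> u) k)"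
        using km u s f_le[OF _ node_orthant[OF \<delta>], of u "cell \<delta> u"] by (simp add: rhs_def)
      also have "\<dots> \<le> q u * h (euler \<delta> k t)"
        using u s nk node_le_euler[OF \<delta>, of u t k]
        by (intro mult_left_mono mono_onD[OF h(1)] q_nonneg) auto
      finally show "rhs u (node \<delta> (cell \<delta> u)) (m - 1) \<le> q u * h (euler \<delta> k t)" .
    qed
    also have "\<dots> = h (euler \<delta> k t) * (Q t - Q s)" using Q[of s t] s by simp
    finally show ?thesis .
  qed
qed

lemma euler_uniform_bound:
  "\<exists>B\<ge>0. \<forall>\<delta>>0. \<forall>i. \<forall>t\<in>{t0..b}. euler \<delta> i t \<le> B"
proof -
  obtain B where B: "0 \<le> B" "\<And>y t i. growth_chain m k h Q {t0..t} y \<Longrightarrow> t0 \<le> t \<Longrightarrow> t \<le> b \<Longrightarrow>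
      (\<And>i. i < m \<Longrightarrow> y i t0 \<le> c i) \<Longrightarrow> i < m \<Longrightarrow> y i t \<le> B"
  proof -
    have c0: "0 \<le> c i" if "i < m" for i using c_orthant by (simp add: orthant_def)
    have Qm: "mono_on {t0..b} Q" using Q_mono by (rule mono_on_subset) auto
    show thesis
      by (rule growth_chain_a_priori_all[OF km c0 h divergent Qm Q_continuous])
        (assumption, assumption, assumption, rule that, assumption, blast)
  qed
  show ?thesis
  proof (intro exI[of _ B] conjI B(1) allI impI ballI)
    fix \<delta> i t assume a: "0 < (\<delta>::real)" "t \<in> {t0..b}"
    show "euler \<delta> i t \<le> B"
    proof (cases "i < m")
      case True
      show ?thesis
        by (rule B(2)[OF growth_chain_subset[OF euler_growth_chain[OF a(1)]] _ _ _ True])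
          (use a in \<open>auto simp: euler_start\<close>)
    next
      case False thus ?thesis using euler_orthant[of \<delta> t] a B(1) by (simp add: orthant_def)
    qed
  qed
qed

lemma euler_equicontinuous:
  "\<exists>G. continuous_on {t0..b} G \<and>
    (\<forall>\<delta>>0. \<forall>i. \<forall>s\<in>{t0..b}. \<forall>t\<in>{t0..b}. \<bar>euler \<delta> i t - euler \<delta> i s\<bar> \<le> \<bar>G t - G s\<bar>)"
proof -
  obtain B where B: "0 \<le> B" "\<And>\<delta> i t. 0 < \<delta> \<Longrightarrow> t \<in> {t0..b} \<Longrightarrow> euler \<delta> i t \<le> B"
    using euler_uniform_bound[of b] by meson
  define G where "G t = B * t + h B * Q t" for t
  have Gc: "continuous_on {t0..b} G" unfolding G_def
    by (intro continuous_on_add continuous_on_mult continuous_on_const continuous_on_id Q_continuous)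
  have *: "\<bar>euler \<delta> i t - euler \<delta> i s\<bar> \<le> \<bar>G t - G s\<bar>"
    if d: "0 < \<delta>" and st: "s \<in> {t0..b}" "t \<in> {t0..b}" "s \<le> t" for \<delta> i s t
  proof (cases "i < m")
    case True
    have b: "b \<in> {t0..b}" using st by auto
    have "0 \<le> euler \<delta> k b" using euler_orthant[of \<delta> b] b d by (simp add: orthant_def)
    hence "h (euler \<delta> k b) \<le> h B" using B(1) B(2)[OF d b] by (intro mono_onD[OF h(1)]) auto
    hence "euler \<delta> i t - euler \<delta> i s \<le> B * (t - s) + h B * (Q t - Q s)"
      using st b B(1) h(3)[of B] mono_onD[OF Q_mono, of s t]
      by (intro growth_chain_modulus[OF euler_growth_chain[OF d] True km, of s t b] B(2)[OF d b] h(1)) auto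
    also have "\<dots> = G t - G s" by (simp add: G_def algebra_simps)
    finally show ?thesis using euler_mono[OF d, of s t i] st by auto
  next
    case False thus ?thesis using euler_orthant[of \<delta> t] euler_orthant[of \<delta> s] st d by (simp add: orthant_def)
  qed
  have "\<bar>euler \<delta> i t - euler \<delta> i s\<bar> \<le> \<bar>G t - G s\<bar>"
    if "0 < \<delta>" "s \<in> {t0..b}" "t \<in> {t0..b}" for \<delta> i s t
    using *[OF that] *[OF that(1,3,2)] by (cases "s \<le> t") (auto simp: abs_minus_commute)
  with Gc show ?thesis by blast
qed

text \<open>
  A pointwise limit \<open>y\<close> of Euler polygons. The a priori bound makes them uniformly bounded on compact
  intervals, hence equicontinuous and dominated there; the frozen states have the same limit as the
  polygons, because grid points approach every time. Dominated convergence then yields the integral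
  equation. The lower bound on the increments can fail for polygons and is read off from this
  equation.
\<close>

lemma global_solution:
  obtains y where "\<And>i. y i t0 = c i" "growth_chain m k h Q {t0..} y"
    "\<And>i s t. Suc i < m \<Longrightarrow> t0 \<le> s \<Longrightarrow> s \<le> t \<Longrightarrow> (t - s) * y (Suc i) s \<le> y i t - y i s"
    "\<And>t. t0 \<le> t \<Longrightarrow> (\<lambda>i. y i t) \<in> orthant m"
    "\<And>t. t0 \<le> t \<Longrightarrow> (\<lambda>s. f s (\<lambda>i. y i s)) integrable_on {t0..t}"
    "\<And>t. t0 \<le> t \<Longrightarrow> y (m - 1) t = c (m - 1) + integral {t0..t} (\<lambda>s. f s (\<lambda>i. y i s))"
proof -
  define \<delta> where "\<delta> n = inverse (real (Suc n))" for n
  have \<delta>: "0 < \<delta> n" for n unfolding \<delta>_def by (rule positive_imp_inverse_positive) simp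
  obtain r where r: "strict_mono r" "\<And>i t. t0 \<le> t \<Longrightarrow> \<exists>L. (\<lambda>n. euler (\<delta> (r n)) i t) \<longlonglongrightarrow> L"
  proof (rule equicontinuous_pointwise_subsequence[of t0 "\<lambda>n. euler (\<delta> n)"])
    fix t assume t: "t0 \<le> t"
    obtain B where "\<And>\<delta> i u. 0 < \<delta> \<Longrightarrow> u \<in> {t0..t} \<Longrightarrow> euler \<delta> i u \<le> B"
      using euler_uniform_bound[of t] by meson
    hence "\<bar>euler (\<delta> n) i t\<bar> \<le> B" for n i
      using euler_orthant[OF \<delta> t, of n] \<delta> t by (simp add: orthant_def)
    thus "\<exists>B. \<forall>n i. \<bar>euler (\<delta> n) i t\<bar> \<le> B" by blast
    obtain G where "continuous_on {t0..t} G"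
      "\<And>\<delta> i s u. 0 < \<delta> \<Longrightarrow> s \<in> {t0..t} \<Longrightarrow> u \<in> {t0..t} \<Longrightarrow> \<bar>euler \<delta> i u - euler \<delta> i s\<bar> \<le> \<bar>G u - G s\<bar>"
      using euler_equicontinuous[of t] by meson
    thus "\<exists>G. continuous_on {t0..t} G \<and>
      (\<forall>n i. \<forall>s\<in>{t0..t}. \<forall>u\<in>{t0..t}. \<bar>euler (\<delta> n) i u - euler (\<delta> n) i s\<bar> \<le> \<bar>G u - G s\<bar>)"
      using \<delta> by blast
  qed blast
  define Y where "Y n = euler (\<delta> (r n))" for n
  define y where "y i t = lim (\<lambda>n. Y n i t)" for i t
  have conv: "(\<lambda>n. Y n i t) \<longlonglongrightarrow> y i t" if "t0 \<le> t" for i t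
    using r(2)[OF that] unfolding y_def Y_def by (metis limI)
  have \<delta>_lim: "(\<lambda>n. \<delta> (r n)) \<longlonglongrightarrow> 0"
    using LIMSEQ_subseq_LIMSEQ[OF LIMSEQ_inverse_real_of_nat r(1)] by (simp add: \<delta>_def o_def)
  have chY: "growth_chain m k h Q {t0..} (Y n)" for n unfolding Y_def by (rule euler_growth_chain[OF \<delta>])
  have y_orthant: "(\<lambda>i. y i t) \<in> orthant m" if t: "t0 \<le> t" for t
  proof -
    have "0 \<le> Y n i t" "m \<le> i \<Longrightarrow> Y n i t = 0" for n i
      using euler_orthant[OF \<delta> t] unfolding Y_def orthant_def by auto
    hence "0 \<le> y i t" "m \<le> i \<Longrightarrow> y i t = 0" for i
      using LIMSEQ_le_const[OF conv[OF t]] LIMSEQ_unique[OF conv[OF t], of i 0] by auto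
    thus ?thesis by (simp add: orthant_def)
  qed
  have y_mono: "y i s \<le> y i t" if "t0 \<le> s" "s \<le> t" for i s t
    using that euler_mono[OF \<delta>] by (intro LIMSEQ_le[OF conv conv]) (auto simp: Y_def)
  have chain: "growth_chain m k h Q {t0..} y"
    unfolding growth_chain_def
  proof (intro conjI allI ballI impI)
    show "0 \<le> y i t" if "t \<in> {t0..}" for i t
      using y_orthant[of t] that by (simp add: orthant_def)
    show "y i s \<le> y i t" if "s \<in> {t0..}" "s \<le> t" for i s t using y_mono that by simp
    show "y i t - y i s \<le> (t - s) * y (Suc i) t" if "Suc i < m" "s \<in> {t0..}" "t \<in> {t0..}" "s \<le> t" for i s t
      using growth_chain_slope[OF chY that] that
      by (intro LIMSEQ_le[OF tendsto_diff[OF conv conv] tendsto_mult[OF tendsto_const conv]]) auto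
    show "y (m - 1) t - y (m - 1) s \<le> h (y k t) * (Q t - Q s)" if st: "s \<in> {t0..}" "t \<in> {t0..}" "s \<le> t" for s t
    proof (rule LIMSEQ_le[OF tendsto_diff[OF conv conv]])
      have "(\<lambda>n. h (Y n k t)) \<longlonglongrightarrow> h (y k t)"
        using st y_orthant[of t] growth_chain_nonneg[OF chY km st(2)]
        by (intro continuous_on_tendsto_compose[OF h(2) conv]) (auto simp: orthant_def)
      thus "(\<lambda>n. h (Y n k t) * (Q t - Q s)) \<longlonglongrightarrow> h (y k t) * (Q t - Q s)" by (intro tendsto_intros)
    qed (use growth_chain_top[OF chY st] st in auto)
  qed
  \<comment> \<open>the frozen states that enter the right-hand side\<close>
  define x where "x n s = node (\<delta> (r n)) (cell (\<delta> (r n)) s)" for n s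
  have x_orthant: "x n s \<in> orthant m" for n s unfolding x_def by (rule node_orthant[OF \<delta>])
  have x_lim: "(\<lambda>n. x n s i) \<longlonglongrightarrow> y i s" if s: "t0 \<le> s" for i s
  proof -
    obtain G where G: "continuous_on {t0..s} G"
      "\<And>\<delta> i u v. 0 < \<delta> \<Longrightarrow> u \<in> {t0..s} \<Longrightarrow> v \<in> {t0..s} \<Longrightarrow> \<bar>euler \<delta> i v - euler \<delta> i u\<bar> \<le> \<bar>G v - G u\<bar>"
      using euler_equicontinuous[of s] by meson
    \<comment> \<open>the grid point at which the state in force at time \<open>s\<close> was frozen\<close>
    define g where "g n = t0 + real (cell (\<delta> (r n)) s) * \<delta> (r n)" for n
    have g: "t0 \<le> g n" "g n \<le> s" "s - \<delta> (r n) \<le> g n" for n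
      using cell_bounds[OF \<delta>[of "r n"] s] \<delta>[of "r n"] by (auto simp: g_def)
    have "g \<longlonglongrightarrow> s"
      by (rule tendsto_sandwich[of "\<lambda>n. s - \<delta> (r n)" _ _ "\<lambda>_. s"])
        (use g tendsto_diff[OF tendsto_const \<delta>_lim, of s] in auto)
    hence "(\<lambda>n. G (g n)) \<longlonglongrightarrow> G s"
      using g s by (intro continuous_on_tendsto_compose[OF G(1)]) auto
    hence "(\<lambda>n. \<bar>G s - G (g n)\<bar>) \<longlonglongrightarrow> \<bar>G s - G s\<bar>" by (intro tendsto_intros)
    hence Glim: "(\<lambda>n. \<bar>G s - G (g n)\<bar>) \<longlonglongrightarrow> 0" by simp
    have "norm (x n s i - Y n i s) \<le> \<bar>G s - G (g n)\<bar>" for n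
      using G(2)[OF \<delta>[of "r n"], of "g n" s i] g[of n] s euler_at_node[OF \<delta>[of "r n"], of i "cell (\<delta> (r n)) s"]
      by (simp add: x_def Y_def g_def abs_minus_commute)
    hence "(\<lambda>n. x n s i - Y n i s) \<longlonglongrightarrow> 0"
      by (intro Lim_null_comparison[OF _ Glim] always_eventually) simp
    from tendsto_add[OF this conv[OF s, of i]] show ?thesis by simp
  qed
  have rhs_lim: "(\<lambda>n. rhs s (x n s) i) \<longlonglongrightarrow> rhs s (\<lambda>i. y i s) i" if s: "t0 \<le> s" for s i
    using x_lim[OF s] f_continuous[OF s x_orthant y_orthant[OF s] x_lim[OF s]] by (simp add: rhs_def)
  have "(\<lambda>s. rhs s (\<lambda>i. y i s) i) integrable_on {t0..t} \<and>
      (\<lambda>n. integral {t0..t} (\<lambda>s. rhs s (x n s) i)) \<longlonglongrightarrow> integral {t0..t} (\<lambda>s. rhs s (\<lambda>i. y i s) i)"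
    if t: "t0 \<le> t" for i t
  proof -
    obtain B where B: "0 \<le> B" "\<And>\<delta> i u. 0 < \<delta> \<Longrightarrow> u \<in> {t0..t} \<Longrightarrow> euler \<delta> i u \<le> B"
      using euler_uniform_bound[of t] by meson
    have bound: "norm (rhs s (x n s) i) \<le> B + q s * h B" if s: "s \<in> {t0..t}" for n s
    proof -
      have xB: "x n s j \<le> B" for j
        using node_le_euler[OF \<delta>[of "r n"], of s s j] B(2)[OF \<delta>[of "r n"] s, of j] s by (simp add: x_def)
      have xk: "0 \<le> x n s k" using x_orthant[of n s] by (simp add: orthant_def)
      have "f s (x n s) \<le> q s * h (x n s k)" using f_le[OF _ x_orthant] s by simp
      also have "\<dots> \<le> q s * h B"
        using xk xB B(1) s by (intro mult_left_mono mono_onD[OF h(1)] q_nonneg) auto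
      finally have "f s (x n s) \<le> q s * h B" .
      moreover have "0 \<le> q s * h B" using q_nonneg h(3)[OF B(1)] s by simp
      ultimately have "rhs s (x n s) i \<le> B + q s * h B"
        using xB[of "Suc i"] B(1) by (auto simp: rhs_def)
      thus ?thesis using rhs_nonneg[OF _ x_orthant, of s n s i] s by simp
    qed
    have "(\<lambda>s. B + q s * h B) integrable_on {t0..t}"
      by (intro integrable_add integrable_on_mult_left q_integrable) auto
    moreover have "(\<lambda>s. rhs s (x n s) i) integrable_on {t0..t}" for n
      unfolding x_def by (rule euler_rhs_integrable[OF \<delta> order_refl])
    ultimately show ?thesis
      using dominated_convergence[of "\<lambda>n s. rhs s (x n s) i" "{t0..t}" "\<lambda>s. B + q s * h B"
          "\<lambda>s. rhs s (\<lambda>i. y i s) i"] bound rhs_lim by simp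
  qed note DC = this
  have eq: "y i t = c i + integral {t0..t} (\<lambda>s. rhs s (\<lambda>i. y i s) i)" if t: "t0 \<le> t" for i t
  proof (rule LIMSEQ_unique[OF conv[OF t]])
    show "(\<lambda>n. Y n i t) \<longlonglongrightarrow> c i + integral {t0..t} (\<lambda>s. rhs s (\<lambda>i. y i s) i)"
      unfolding Y_def euler_def x_def[symmetric] using DC[OF t, of i] by (intro tendsto_intros) simp
  qed
  have steep: "(t - s) * y (Suc i) s \<le> y i t - y i s" if i: "Suc i < m" and st: "t0 \<le> s" "s \<le> t" for i s t
  proof -
    have ii: "(\<lambda>s. y (Suc i) s) integrable_on {t0..t}" using DC[of t i] i st by (simp add: rhs_def)
    have "(t - s) * y (Suc i) s = integral {s..t} (\<lambda>_. y (Suc i) s)" using st by simp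
    also have "\<dots> \<le> integral {s..t} (\<lambda>u. y (Suc i) u)"
      using st y_mono by (intro integral_le integrable_on_subinterval[OF ii]) auto
    also have "\<dots> = y i t - y i s"
      using Henstock_Kurzweil_Integration.integral_combine[OF st ii] eq[of t i] eq[of s i] st i by (simp add: rhs_def)
    finally show ?thesis .
  qed
  have m: "Suc (m - 1) = m" using km by simp
  show thesis
  proof (rule that[of y])
    show "y i t0 = c i" for i using eq[of t0 i] by simp
    show "(\<lambda>s. f s (\<lambda>i. y i s)) integrable_on {t0..t}" if "t0 \<le> t" for t
      using DC[OF that, of "m - 1"] m by (simp add: rhs_def)
    show "y (m - 1) t = c (m - 1) + integral {t0..t} (\<lambda>s. f s (\<lambda>i. y i s))" if "t0 \<le> t" for t
      using eq[OF that, of "m - 1"] m by (simp add: rhs_def)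
  qed (use chain steep y_orthant in auto)
qed

end

section \<open>Assembling solutions from growth chains\<close>

lemma mean_value_increment:
  fixes F g :: "real \<Rightarrow> real"
  assumes d: "\<And>t. t \<in> S \<Longrightarrow> (F has_vector_derivative g t) (at t within S)"
    and "{s..t} \<subseteq> S" "s \<le> t"
  obtains \<xi> where "\<xi> \<in> {s..t}" "F t - F s = (t - s) * g \<xi>"
proof (cases "s = t")
  case True
  thus thesis using that[of s] by simp
next
  case False
  hence "s < t" using assms(3) by simp
  moreover have "(F has_derivative (\<lambda>u. u * g x)) (at x within {s..t})" if "s \<le> x" "x \<le> t" for x
    using has_vector_derivative_within_subset[OF d assms(2)] that assms(2)
    by (auto simp: has_vector_derivative_def)
  ultimately obtain x where "x \<in> {s<..<t}" "F t - F s = (t - s) * g x"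
    using mvt_simple[of s t F "\<lambda>x u. u * g x"] by blast
  thus thesis using that[of x] by auto
qed

text \<open>
  Differentiability from a two-sided bound on difference quotients. It treats the junction of the old
  and the new solution in the same way as all other points.
\<close>

lemma has_vector_derivative_squeezed:
  fixes F g :: "real \<Rightarrow> real"
  assumes lo: "\<And>s t. s \<in> S \<Longrightarrow> t \<in> S \<Longrightarrow> s \<le> t \<Longrightarrow> (t - s) * g s \<le> F t - F s"
    and hi: "\<And>s t. s \<in> S \<Longrightarrow> t \<in> S \<Longrightarrow> s \<le> t \<Longrightarrow> F t - F s \<le> (t - s) * g t"
    and g: "continuous (at t within S) g" and t: "t \<in> S"
  shows "(F has_vector_derivative g t) (at t within S)"
  unfolding has_vector_derivative_def has_derivative_within_alt
proof (intro conjI allI impI)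
  show "bounded_linear (\<lambda>x. x *\<^sub>R g t)" by (rule bounded_linear_scaleR_left)
  fix e :: real assume "e > 0"
  then obtain d where d: "d > 0" "\<And>x. x \<in> S \<Longrightarrow> dist x t < d \<Longrightarrow> dist (g x) (g t) < e"
    using g unfolding continuous_within_eps_delta by metis
  have "\<bar>F y - F t - (y - t) * g t\<bar> \<le> e * \<bar>y - t\<bar>" if y: "y \<in> S" "\<bar>y - t\<bar> < d" for y
  proof -
    have e: "\<bar>g y - g t\<bar> \<le> e" using d(2)[OF y(1)] y(2) by (simp add: dist_real_def)
    have "\<bar>F y - F t - (y - t) * g t\<bar> \<le> \<bar>y - t\<bar> * \<bar>g y - g t\<bar>"
    proof (cases "t \<le> y")
      case True
      have "0 \<le> F y - F t - (y - t) * g t" using lo[OF t y(1) True] by simp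
      moreover have "F y - F t - (y - t) * g t \<le> (y - t) * (g y - g t)"
        using hi[OF t y(1) True] by (simp add: algebra_simps)
      moreover have "\<dots> \<le> \<bar>y - t\<bar> * \<bar>g y - g t\<bar>" using abs_mult by (metis abs_ge_self)
      ultimately show ?thesis by linarith
    next
      case False
      hence yt: "y \<le> t" by simp
      have "0 \<le> F y - F t - (y - t) * g t" using hi[OF y(1) t yt] by (simp add: algebra_simps)
      moreover have "F y - F t - (y - t) * g t \<le> (y - t) * (g y - g t)"
        using lo[OF y(1) t yt] by (simp add: algebra_simps)
      moreover have "\<dots> \<le> \<bar>y - t\<bar> * \<bar>g y - g t\<bar>" using abs_mult by (metis abs_ge_self)
      ultimately show ?thesis by linarith
    qed
    also have "\<dots> \<le> \<bar>y - t\<bar> * e" using e by (rule mult_left_mono) simp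
    finally show ?thesis by (simp add: mult.commute)
  qed
  thus "\<exists>d>0. \<forall>y\<in>S. norm (y - t) < d \<longrightarrow> norm (F y - F t - (y - t) *\<^sub>R g t) \<le> e * norm (y - t)"
    using d(1) by auto
qed

lemma at_within_atLeast_neq_bot: "(c::real) \<le> t \<Longrightarrow> at t within {c..} \<noteq> bot"
proof -
  assume "c \<le> t"
  hence "at_right t \<le> at t within {c..}" by (intro at_le) auto
  thus ?thesis using trivial_limit_at_right_real[of t] by (metis bot.extremum_uniqueI)
qed

lemma orthant_subset_topspace: "orthant m \<subseteq> topspace (Euclidean_space m)"
  by (auto simp: orthant_def topspace_Euclidean_space)

lemma continuous_map_Euclidean_space_sequentially:
  assumes f: "continuous_map (Euclidean_space m) euclideanreal f"
    and X: "\<And>n. X n \<in> topspace (Euclidean_space m)" "x \<in> topspace (Euclidean_space m)"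
    and lim: "\<And>i. (\<lambda>n. X n i) \<longlonglongrightarrow> x i"
  shows "(\<lambda>n. f (X n)) \<longlonglongrightarrow> f x"
proof -
  have "limitin (powertop_real UNIV) X x sequentially"
    using lim by (simp add: limitin_componentwise)
  hence "limitin (Euclidean_space m) X x sequentially"
    using X unfolding Euclidean_space_def by (auto simp: limitin_subtopology)
  from continuous_map_limit[OF f this] have "limitin euclideanreal (f \<circ> X) (f x) sequentially" by simp
  thus ?thesis by (simp add: o_def)
qed

lemma abs_continuous_on_interval_uminus:
  "abs_continuous_on_interval a b g \<Longrightarrow> abs_continuous_on_interval a b (\<lambda>t. - g t)"
  by (simp add: abs_continuous_on_interval_def abs_minus_commute)

text \<open>
  Across \<open>b\<close> the estimates on both sides add up, since \<open>y (Suc i) b\<close> and \<open>h (y k b)\<close> only increase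
  when \<open>b\<close> is replaced by a later time.
\<close>

lemma growth_chain_glue:
  assumes I: "growth_chain m k h Q {a..b} y" and J: "growth_chain m k h Q {b..} y"
    and ab: "a \<le> b" and k: "k < m" and h: "mono_on {0..} h" and Q: "mono_on {a..} Q"
  shows "growth_chain m k h Q {a..} y"
  unfolding growth_chain_def
proof (intro conjI allI impI ballI)
  note nonneg = growth_chain_nonneg[OF I] growth_chain_nonneg[OF J]
  note mono = growth_chain_mono[OF I] growth_chain_mono[OF J]
  show "0 \<le> y i t" if "i < m" "t \<in> {a..}" for i t
    using that nonneg[of i t] by (cases "t \<le> b") auto
  show "y i s \<le> y i t" if st: "i < m" "s \<in> {a..}" "t \<in> {a..}" "s \<le> t" for i s t
  proof -
    consider "t \<le> b" | "b \<le> s" | "s \<le> b" "b \<le> t" by linarith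
    thus ?thesis
      using st mono(1)[of i s t] mono(2)[of i s t] mono(1)[of i s b] mono(2)[of i b t] by cases auto
  qed
  show "y i t - y i s \<le> (t - s) * y (Suc i) t"
    if st: "Suc i < m" "s \<in> {a..}" "t \<in> {a..}" "s \<le> t" for i s t
  proof -
    consider "t \<le> b" | "b \<le> s" | "s \<le> b" "b \<le> t" by linarith
    thus ?thesis
    proof cases
      case 3
      have "y i b - y i s \<le> (b - s) * y (Suc i) b" using growth_chain_slope[OF I st(1)] st 3 ab by simp
      also have "\<dots> \<le> (b - s) * y (Suc i) t"
        using mono(2)[OF st(1), of b t] 3 by (intro mult_left_mono) auto
      also have "(b - s) * y (Suc i) t = (t - s) * y (Suc i) t - (t - b) * y (Suc i) t"
        by (simp add: algebra_simps)
      finally show ?thesis using growth_chain_slope[OF J st(1), of b t] 3 by simp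
    qed (use growth_chain_slope[OF I st(1)] growth_chain_slope[OF J st(1)] st in auto)
  qed
  show "y (m - 1) t - y (m - 1) s \<le> h (y k t) * (Q t - Q s)"
    if st: "s \<in> {a..}" "t \<in> {a..}" "s \<le> t" for s t
  proof -
    consider "t \<le> b" | "b \<le> s" | "s \<le> b" "b \<le> t" by linarith
    thus ?thesis
    proof cases
      case 3
      have "y (m - 1) b - y (m - 1) s \<le> h (y k b) * (Q b - Q s)"
        using growth_chain_top[OF I, of s b] st 3 ab by simp
      also have "\<dots> \<le> h (y k t) * (Q b - Q s)"
      proof (rule mult_right_mono)
        show "h (y k b) \<le> h (y k t)"
          using mono(2)[OF k, of b t] nonneg(2)[OF k] 3 by (intro mono_onD[OF h]) auto
        show "0 \<le> Q b - Q s" using mono_onD[OF Q, of s b] st 3 by simp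
      qed
      also have "\<dots> = h (y k t) * (Q t - Q s) - h (y k t) * (Q t - Q b)" by (simp add: algebra_simps)
      finally show ?thesis using growth_chain_top[OF J, of b t] 3 by simp
    qed (use growth_chain_top[OF I] growth_chain_top[OF J] st in auto)
  qed
qed

lemma steep_glue:
  fixes F g :: "real \<Rightarrow> real"
  assumes I: "\<And>s t. a \<le> s \<Longrightarrow> s \<le> t \<Longrightarrow> t \<le> b \<Longrightarrow> (t - s) * g s \<le> F t - F s"
    and J: "\<And>s t. b \<le> s \<Longrightarrow> s \<le> t \<Longrightarrow> (t - s) * g s \<le> F t - F s"
    and g: "\<And>s. a \<le> s \<Longrightarrow> s \<le> b \<Longrightarrow> g s \<le> g b"
    and st: "a \<le> s" "s \<le> t"
  shows "(t - s) * g s \<le> F t - F s"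
proof -
  consider "t \<le> b" | "b \<le> s" | "s \<le> b" "b \<le> t" by linarith
  thus ?thesis
  proof cases
    case 3
    have "(t - b) * g s \<le> (t - b) * g b" using g[of s] st 3 by (intro mult_left_mono) auto
    also have "\<dots> \<le> F t - F b" using J 3 by simp
    finally show ?thesis using I[of s b] st 3 by (simp add: algebra_simps)
  qed (use I J st in auto)
qed

text \<open>
  A bounded monotone chain has limits at the right end of its interval, and non-strict inequalities
  survive the limit. The limits \<open>c\<close> become the initial data of the continuation; \<open>y\<close> is left arbitrary
  outside of \<open>{a..b}\<close> so that the result applies to the glued function.
\<close>

lemma growth_chain_extend_endpoint:
  assumes ch: "growth_chain m k h Q {a..<b} z" and ab: "a < b" and k: "k < m"
    and h: "mono_on {0..} h" "continuous_on {0..} h" and Q: "continuous_on {a..b} Q"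
    and bound: "\<And>i t. i < m \<Longrightarrow> t \<in> {a..<b} \<Longrightarrow> z i t \<le> B"
    and steep: "\<And>i s t. Suc i < m \<Longrightarrow> a \<le> s \<Longrightarrow> s \<le> t \<Longrightarrow> t < b \<Longrightarrow> (t - s) * z (Suc i) s \<le> z i t - z i s"
  obtains c where "\<And>i. 0 \<le> c i" "\<And>i. m \<le> i \<Longrightarrow> c i = 0"
    "\<And>y. (\<And>i t. i < m \<Longrightarrow> t \<in> {a..<b} \<Longrightarrow> y i t = z i t) \<Longrightarrow> (\<And>i. i < m \<Longrightarrow> y i b = c i) \<Longrightarrow>
       growth_chain m k h Q {a..b} y \<and>
       (\<forall>i s t. Suc i < m \<longrightarrow> a \<le> s \<longrightarrow> s \<le> t \<longrightarrow> t \<le> b \<longrightarrow> (t - s) * y (Suc i) s \<le> y i t - y i s)"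
proof -
  \<comment> \<open>a sequence in \<open>{a..<b}\<close> that increases to \<open>b\<close>\<close>
  define \<tau> where "\<tau> n = b - (b - a) * inverse (real (Suc n))" for n
  have \<tau>: "\<tau> n \<in> {a..<b}" for n
  proof -
    have "inverse (real (Suc n)) \<le> 1" "0 < inverse (real (Suc n))" by (auto simp: field_simps)
    hence "(b - a) * inverse (real (Suc n)) \<le> b - a" "0 < (b - a) * inverse (real (Suc n))"
      using ab mult_left_mono[of "inverse (real (Suc n))" 1 "b - a"] by auto
    thus ?thesis by (auto simp: \<tau>_def)
  qed
  have "(\<lambda>n. b - (b - a) * inverse (real (Suc n))) \<longlonglongrightarrow> b - (b - a) * 0"
    by (intro tendsto_intros LIMSEQ_inverse_real_of_nat)
  hence \<tau>_lim: "\<tau> \<longlonglongrightarrow> b" by (simp add: \<tau>_def[abs_def])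
  have "incseq \<tau>"
    unfolding \<tau>_def using ab by (intro incseq_SucI diff_left_mono mult_left_mono le_imp_inverse_le) auto
  hence \<tau>_mono: "\<tau> n \<le> \<tau> n'" if "n \<le> n'" for n n' using that by (rule incseqD)
  define c where "c i = (if i < m then lim (\<lambda>n. z i (\<tau> n)) else 0)" for i
  have c: "(\<lambda>n. z i (\<tau> n)) \<longlonglongrightarrow> c i" if i: "i < m" for i
  proof -
    have "incseq (\<lambda>n. z i (\<tau> n))"
      by (intro incseq_SucI growth_chain_mono[OF ch i] \<tau> \<tau>_mono) simp
    moreover have "\<forall>n. z i (\<tau> n) \<le> B" using bound[OF i] \<tau> by blast
    ultimately obtain L where "(\<lambda>n. z i (\<tau> n)) \<longlonglongrightarrow> L" by (rule incseq_convergent)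
    thus ?thesis using i by (simp add: c_def limI)
  qed
  have ev: "\<exists>N. \<forall>n\<ge>N. t \<le> \<tau> n" if "t < b" for t
    using order_tendstoD(1)[OF \<tau>_lim that] by (auto simp: eventually_sequentially intro: less_imp_le)
  have zc: "z i t \<le> c i" if "i < m" "t \<in> {a..<b}" for i t
    using ev[of t] that growth_chain_mono[OF ch that(1,2) \<tau>] by (intro LIMSEQ_le_const[OF c]) auto
  have c0: "0 \<le> c i" for i
    using zc[of i a] growth_chain_nonneg[OF ch, of i a] ab by (cases "i < m") (force simp: c_def)+
  show thesis
  proof (rule that[of c])
    show "0 \<le> c i" for i by (rule c0)
    show "c i = 0" if "m \<le> i" for i using that by (simp add: c_def)
    fix y assume y: "\<And>i t. i < m \<Longrightarrow> t \<in> {a..<b} \<Longrightarrow> y i t = z i t" "\<And>i. i < m \<Longrightarrow> y i b = c i"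
    have sl: "y i b - y i s \<le> (b - s) * y (Suc i) b" "(b - s) * y (Suc i) s \<le> y i b - y i s"
      if i: "Suc i < m" and s: "s \<in> {a..<b}" for i s
    proof -
      obtain N where N: "\<forall>n\<ge>N. s \<le> \<tau> n" using ev[of s] s by auto
      have im: "i < m" using i by simp
      have l: "(\<lambda>n. z i (\<tau> n) - z i s) \<longlonglongrightarrow> c i - z i s"
        by (intro tendsto_intros c im)
      have "\<forall>n\<ge>N. z i (\<tau> n) - z i s \<le> (\<tau> n - s) * z (Suc i) (\<tau> n)"
        using growth_chain_slope[OF ch i s \<tau>] N by blast
      hence "c i - z i s \<le> (b - s) * c (Suc i)"
        by (intro LIMSEQ_le[OF l tendsto_mult[OF tendsto_diff[OF \<tau>_lim tendsto_const] c[OF i]]]) blast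
      thus "y i b - y i s \<le> (b - s) * y (Suc i) b" using y s i im by simp
      have "\<forall>n\<ge>N. (\<tau> n - s) * z (Suc i) s \<le> z i (\<tau> n) - z i s"
        using steep[OF i, of s] N \<tau> s by auto
      hence "(b - s) * z (Suc i) s \<le> c i - z i s"
        by (intro LIMSEQ_le[OF tendsto_mult[OF tendsto_diff[OF \<tau>_lim tendsto_const] tendsto_const] l]) blast
      thus "(b - s) * y (Suc i) s \<le> y i b - y i s" using y s i im by simp
    qed
    have top: "y (m - 1) b - y (m - 1) s \<le> h (y k b) * (Q b - Q s)" if s: "s \<in> {a..<b}" for s
    proof -
      obtain N where N: "\<forall>n\<ge>N. s \<le> \<tau> n" using ev[of s] s by auto
      have m1: "m - 1 < m" using k by simp
      have l: "(\<lambda>n. z (m - 1) (\<tau> n) - z (m - 1) s) \<longlonglongrightarrow> c (m - 1) - z (m - 1) s"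
        by (intro tendsto_intros c m1)
      have hl: "(\<lambda>n. h (z k (\<tau> n))) \<longlonglongrightarrow> h (c k)"
        using c0 growth_chain_nonneg[OF ch k \<tau>] by (intro continuous_on_tendsto_compose[OF h(2) c[OF k]]) auto
      have Ql: "(\<lambda>n. Q (\<tau> n)) \<longlonglongrightarrow> Q b"
        using \<tau> ab by (intro continuous_on_tendsto_compose[OF Q \<tau>_lim]) (auto simp: less_imp_le)
      have "\<forall>n\<ge>N. z (m - 1) (\<tau> n) - z (m - 1) s \<le> h (z k (\<tau> n)) * (Q (\<tau> n) - Q s)"
        using growth_chain_top[OF ch s \<tau>] N by blast
      hence "c (m - 1) - z (m - 1) s \<le> h (c k) * (Q b - Q s)"
        by (intro LIMSEQ_le[OF l tendsto_mult[OF hl tendsto_diff[OF Ql tendsto_const]]]) blast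
      thus ?thesis using y s k m1 by simp
    qed
    have "growth_chain m k h Q {a..b} y"
      unfolding growth_chain_def
    proof (intro conjI allI impI ballI)
      show "0 \<le> y i t" if "i < m" "t \<in> {a..b}" for i t
        using that y c0 growth_chain_nonneg[OF ch] by (cases "t = b") auto
      show "y i s \<le> y i t" if "i < m" "s \<in> {a..b}" "t \<in> {a..b}" "s \<le> t" for i s t
        using that y zc growth_chain_mono[OF ch] by (cases "t = b"; cases "s = b") auto
      show "y i t - y i s \<le> (t - s) * y (Suc i) t"
        if "Suc i < m" "s \<in> {a..b}" "t \<in> {a..b}" "s \<le> t" for i s t
        using that y sl(1) growth_chain_slope[OF ch] by (cases "t = b"; cases "s = b") auto
      show "y (m - 1) t - y (m - 1) s \<le> h (y k t) * (Q t - Q s)"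
        if "s \<in> {a..b}" "t \<in> {a..b}" "s \<le> t" for s t
        using that y top growth_chain_top[OF ch] k by (cases "t = b"; cases "s = b") auto
    qed
    moreover have "(t - s) * y (Suc i) s \<le> y i t - y i s" if "Suc i < m" "a \<le> s" "s \<le> t" "t \<le> b" for i s t
      using that y sl(2) steep by (cases "t = b"; cases "s = b") auto
    ultimately show "growth_chain m k h Q {a..b} y \<and>
       (\<forall>i s t. Suc i < m \<longrightarrow> a \<le> s \<longrightarrow> s \<le> t \<longrightarrow> t \<le> b \<longrightarrow> (t - s) * y (Suc i) s \<le> y i t - y i s)"
      by blast
  qed
qed

section \<open>Solutions as growth chains, and conversely\<close>

lemma solution_has_vector_derivative:
  assumes sol: "is_solution m f T w" and S: "S = upto_time T" and i: "Suc i < m" and t: "t \<in> S"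
  shows "(nth_deriv_within S i w has_vector_derivative nth_deriv_within S (Suc i) w t) (at t within S)"
proof -
  have "nth_deriv_within S i w differentiable (at t within S)"
    using sol i t unfolding is_solution_def S differentiable_on_def by (auto simp: Let_def)
  thus ?thesis by (simp add: vector_derivative_works)
qed

text \<open>
  As \<open>f \<ge> 0\<close>, the top derivative is nondecreasing, and it starts at \<open>a (m - 1) \<ge> 0\<close>. Going down
  from one derivative to the next, the mean value theorem gives nonnegativity, monotonicity and the
  slope bounds. Nonnegativity puts the jet into the orthant, where the growth condition applies.
\<close>

lemma solution_growth_chain:
  assumes km: "k < m" and nonneg: "\<And>t x. 0 \<le> t \<Longrightarrow> x \<in> topspace (Euclidean_space m) \<Longrightarrow> 0 \<le> f t x"
    and N: "negligible N" "\<And>t x. 0 \<le> t \<Longrightarrow> t \<notin> N \<Longrightarrow> x \<in> orthant m \<Longrightarrow> f t x \<le> q t * h (x k)"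
    and q: "\<And>t. 0 \<le> t \<Longrightarrow> 0 \<le> q t" "\<And>b. q integrable_on {0..b}" and h: "mono_on {0..} h"
    and Q: "\<And>s t. 0 \<le> s \<Longrightarrow> s \<le> t \<Longrightarrow> Q t - Q s = integral {s..t} q"
    and a: "\<And>i. i < m \<Longrightarrow> 0 \<le> a i" and sol: "is_cauchy_solution m f a (ereal b) w" and b: "0 < b"
  defines "z \<equiv> \<lambda>i. nth_deriv_within {0..<b} i w"
  shows "growth_chain m k h Q {0..<b} z"
    and "\<And>i s t. Suc i < m \<Longrightarrow> 0 \<le> s \<Longrightarrow> s \<le> t \<Longrightarrow> t < b \<Longrightarrow> (t - s) * z (Suc i) s \<le> z i t - z i s"
proof -
  have S: "{0..<b} = upto_time (ereal b)" by (auto simp: upto_time_def)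
  have is_sol: "is_solution m f (ereal b) w" using sol by (simp add: is_cauchy_solution_def)
  have init: "z i 0 = a i" if "i < m" for i
    using sol that unfolding is_cauchy_solution_def z_def S by simp
  have der: "(z i has_vector_derivative z (Suc i) t) (at t within {0..<b})" if "Suc i < m" "t \<in> {0..<b}" for i t
    unfolding z_def by (rule solution_has_vector_derivative[OF is_sol S that])
  have m1: "m - 1 < m" "Suc (m - 1) = m" using km by auto
  have ac: "abs_continuous_on_interval s t (z (m - 1))" if "0 \<le> s" "s \<le> t" "t < b" for s t
  proof -
    have "locally_abs_continuous_on {0..<b} (z (m - 1))"
      using is_sol m1(1) unfolding is_solution_def Let_def S[symmetric] z_def by blast
    moreover have "{s..t} \<subseteq> {0..<b}" using that by auto
    ultimately show ?thesis unfolding locally_abs_continuous_on_def using that(2) by blast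
  qed
  have "AE t in lebesgue_on {0..<b}. z (m - 1) differentiable (at t within {0..<b}) \<and>
      z m t = f t (jet {0..<b} m w t)"
    using is_sol unfolding is_solution_def Let_def S[symmetric] z_def by simp
  then obtain N1 where N1: "negligible N1" "\<And>t. t \<in> {0..<b} \<Longrightarrow> t \<notin> N1 \<Longrightarrow>
      z (m - 1) differentiable (at t within {0..<b}) \<and> z m t = f t (jet {0..<b} m w t)"
    by (subst (asm) AE_lebesgue_on_iff_negligible) auto
  have top_der: "(z (m - 1) has_vector_derivative f t (jet {0..<b} m w t)) (at t within {0..<b})"
    if t: "t \<in> {0..<b}" "t \<notin> N1" for t
  proof -
    have "(z (m - 1) has_vector_derivative vector_derivative (z (m - 1)) (at t within {0..<b})) (at t within {0..<b})"
      using N1(2)[OF t] by (simp add: vector_derivative_works)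
    moreover have "vector_derivative (z (m - 1)) (at t within {0..<b}) = z m t"
      using nth_deriv_within.simps(2)[of "{0..<b}" "m - 1" w] m1(2) by (simp add: z_def)
    ultimately show ?thesis using N1(2)[OF t] by simp
  qed
  have jet_top: "jet S m w t \<in> topspace (Euclidean_space m)" for S t
    by (simp add: jet_def topspace_Euclidean_space)
  have top_mono: "z (m - 1) s \<le> z (m - 1) t" if st: "0 \<le> s" "s \<le> t" "t < b" for s t
  proof -
    have "- z (m - 1) t - - z (m - 1) s \<le> integral {s..t} (\<lambda>_. 0)"
    proof (rule abs_continuous_on_interval_increment_le[OF st(2) abs_continuous_on_interval_uminus[OF ac[OF st]] N1(1)])
      fix u assume u: "u \<in> {s..t} - N1"
      have "(z (m - 1) has_vector_derivative f u (jet {0..<b} m w u)) (at u within {s..t})"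
        using top_der[of u] u st by (intro has_vector_derivative_within_subset[of _ _ u "{0..<b}" "{s..t}"]) auto
      hence "((\<lambda>u. - z (m - 1) u) has_vector_derivative - f u (jet {0..<b} m w u)) (at u within {s..t})"
        by (rule has_vector_derivative_minus)
      moreover have "0 \<le> f u (jet {0..<b} m w u)" using u st by (intro nonneg jet_top) auto
      ultimately show "\<exists>D. ((\<lambda>t. - z (m - 1) t) has_vector_derivative D) (at u within {s..t}) \<and> D \<le> 0" by force
    qed (rule integrable_0)
    thus ?thesis by simp
  qed
  have "i < m \<Longrightarrow> (\<forall>t\<in>{0..<b}. 0 \<le> z i t) \<and> (\<forall>s\<in>{0..<b}. \<forall>t\<in>{0..<b}. s \<le> t \<longrightarrow> z i s \<le> z i t)" if "i \<le> m - 1" for i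
    using that
  proof (induction i rule: inc_induct)
    case base
    have "0 \<le> z (m - 1) t" if "t \<in> {0..<b}" for t
      using top_mono[of 0 t] init[OF m1(1)] a[OF m1(1)] that unfolding atLeastLessThan_iff by linarith
    thus ?case using top_mono by simp
  next
    case (step i)
    hence i: "Suc i < m" by simp
    have mono: "z i s \<le> z i t" if st: "0 \<le> s" "s \<le> t" "t < b" for s t
    proof -
      obtain \<xi> where \<xi>: "\<xi> \<in> {s..t}" "z i t - z i s = (t - s) * z (Suc i) \<xi>"
        by (rule mean_value_increment[of "{0..<b}" "z i" "z (Suc i)" s t]) (use der[OF i] st in auto)
      have "0 \<le> z (Suc i) \<xi>" using step.IH i \<xi>(1) st by auto
      hence "0 \<le> (t - s) * z (Suc i) \<xi>" using st by (intro mult_nonneg_nonneg) auto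
      thus ?thesis using \<xi>(2) by simp
    qed
    have "0 \<le> z i t" if "t \<in> {0..<b}" for t
      using mono[of 0 t] init[of i] a[of i] i that by auto
    with mono show ?case by auto
  qed
  hence z0: "\<And>i t. i < m \<Longrightarrow> 0 \<le> t \<Longrightarrow> t < b \<Longrightarrow> 0 \<le> z i t"
    and zm: "\<And>i s t. i < m \<Longrightarrow> 0 \<le> s \<Longrightarrow> s \<le> t \<Longrightarrow> t < b \<Longrightarrow> z i s \<le> z i t"
    by auto
  show "(t - s) * z (Suc i) s \<le> z i t - z i s" if st: "Suc i < m" "0 \<le> s" "s \<le> t" "t < b" for i s t
  proof -
    obtain \<xi> where \<xi>: "\<xi> \<in> {s..t}" "z i t - z i s = (t - s) * z (Suc i) \<xi>"
      by (rule mean_value_increment[of "{0..<b}" "z i" "z (Suc i)" s t]) (use der[OF st(1)] st in auto)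
    thus ?thesis using zm[OF st(1), of s \<xi>] st by (auto intro!: mult_left_mono)
  qed
  show "growth_chain m k h Q {0..<b} z"
    unfolding growth_chain_def
  proof (intro conjI allI impI ballI)
    show "0 \<le> z i t" if "i < m" "t \<in> {0..<b}" for i t using z0 that by auto
    show "z i s \<le> z i t" if "i < m" "s \<in> {0..<b}" "t \<in> {0..<b}" "s \<le> t" for i s t using zm that by auto
    show "z i t - z i s \<le> (t - s) * z (Suc i) t" if st: "Suc i < m" "s \<in> {0..<b}" "t \<in> {0..<b}" "s \<le> t" for i s t
    proof -
      obtain \<xi> where \<xi>: "\<xi> \<in> {s..t}" "z i t - z i s = (t - s) * z (Suc i) \<xi>"
        by (rule mean_value_increment[of "{0..<b}" "z i" "z (Suc i)" s t]) (use der[OF st(1)] st in auto)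
      thus ?thesis using zm[OF st(1), of \<xi> t] st by (auto intro!: mult_left_mono)
    qed
    show "z (m - 1) t - z (m - 1) s \<le> h (z k t) * (Q t - Q s)"
      if st: "s \<in> {0..<b}" "t \<in> {0..<b}" "s \<le> t" for s t
    proof -
      have "z (m - 1) t - z (m - 1) s \<le> integral {s..t} (\<lambda>u. q u * h (z k t))"
      proof (rule abs_continuous_on_interval_increment_le[OF st(3) ac negligible_Un[OF N1(1) N(1)]])
        show "(\<lambda>u. q u * h (z k t)) integrable_on {s..t}"
          using st by (intro integrable_on_mult_left integrable_on_subinterval[OF q(2)[of t]]) auto
        fix u assume u: "u \<in> {s..t} - (N1 \<union> N)"
        have "(z (m - 1) has_vector_derivative f u (jet {0..<b} m w u)) (at u within {s..t})"
          using top_der[of u] u st by (intro has_vector_derivative_within_subset[of _ _ u "{0..<b}" "{s..t}"]) auto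
        moreover have "f u (jet {0..<b} m w u) \<le> q u * h (z k t)"
        proof -
          have "jet {0..<b} m w u \<in> orthant m"
            using z0[of _ u] u st by (auto simp: jet_def orthant_def z_def)
          hence "f u (jet {0..<b} m w u) \<le> q u * h (jet {0..<b} m w u k)" using u st by (intro N(2)) auto
          also have "jet {0..<b} m w u k = z k u" using km by (simp add: jet_def z_def)
          also have "q u * h (z k u) \<le> q u * h (z k t)"
            using u st z0[OF km] zm[OF km] by (intro mult_left_mono mono_onD[OF h] q(1)) auto
          finally show ?thesis .
        qed
        ultimately show "\<exists>D. (z (m - 1) has_vector_derivative D) (at u within {s..t}) \<and> D \<le> q u * h (z k t)" by blast
      qed (use st in auto)
      also have "\<dots> = h (z k t) * (Q t - Q s)" using Q[of s t] st by simp
      finally show ?thesis .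
    qed
  qed
qed

text \<open>
  The two almost-everywhere conditions are collected in a single null set, off which they hold
  literally.
\<close>

lemma locally_caratheodory_almost_everywhere:
  assumes f: "locally_caratheodory m f"
    and bound: "AE t in lebesgue_on {0..}.
           \<forall>x \<in> topspace (Euclidean_space m). (\<forall>i<m. 0 \<le> x i) \<longrightarrow> f t x \<le> q t * h (x k)"
  obtains N where "negligible N" "\<And>t. 0 \<le> t \<Longrightarrow> t \<notin> N \<Longrightarrow> continuous_map (Euclidean_space m) euclideanreal (f t)"
    "\<And>t x. 0 \<le> t \<Longrightarrow> t \<notin> N \<Longrightarrow> x \<in> orthant m \<Longrightarrow> f t x \<le> q t * h (x k)"
proof -
  have "AE t in lebesgue_on {0..}. continuous_map (Euclidean_space m) euclideanreal (f t) \<and>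
     (\<forall>x \<in> topspace (Euclidean_space m). (\<forall>i<m. 0 \<le> x i) \<longrightarrow> f t x \<le> q t * h (x k))"
    using f bound unfolding locally_caratheodory_def by (auto intro: AE_conjI)
  then obtain N where N: "negligible N" "\<forall>t\<in>{0..} - N. continuous_map (Euclidean_space m) euclideanreal (f t) \<and>
     (\<forall>x \<in> topspace (Euclidean_space m). (\<forall>i<m. 0 \<le> x i) \<longrightarrow> f t x \<le> q t * h (x k))"
    by (subst (asm) AE_lebesgue_on_iff_negligible) auto
  show thesis
  proof (rule that[OF N(1)])
    fix t x assume "0 \<le> t" "t \<notin> N" "x \<in> orthant m"
    thus "f t x \<le> q t * h (x k)"
      using N(2) orthant_subset_topspace[of m] by (auto simp: orthant_def)
  qed (use N(2) in auto)
qed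

lemma integrable_off_negligible:
  fixes F G :: "real \<Rightarrow> real"
  assumes F: "F \<in> borel_measurable (lebesgue_on {0..})" and N: "negligible N"
    and G: "G integrable_on {a..b}" and a: "0 \<le> a"
    and bound: "\<And>t. t \<in> {a..b} \<Longrightarrow> t \<notin> N \<Longrightarrow> \<bar>F t\<bar> \<le> G t" and G0: "\<And>t. t \<in> {a..b} \<Longrightarrow> 0 \<le> G t"
  shows "(\<lambda>t. if t \<in> N then 0 else F t) integrable_on {a..b}"
proof (rule measurable_bounded_by_integrable_imp_integrable_real[OF _ G])
  have "F \<in> borel_measurable (lebesgue_on {a..b})"
    by (rule measurable_restrict_mono[OF F]) (use a in auto)
  moreover have "N \<in> sets lebesgue" using N by (rule negligible_imp_sets)
  hence "{t \<in> space (lebesgue_on {a..b}). t \<in> N} \<in> sets (lebesgue_on {a..b})"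
    by (auto simp: sets_restrict_space space_restrict_space)
  ultimately show "(\<lambda>t. if t \<in> N then 0 else F t) \<in> borel_measurable (lebesgue_on {a..b})"
    by (intro measurable_If) auto
qed (use bound G0 in auto)

text \<open>
  The converse passage: the slope bounds from both sides recover the derivatives of order below
  \<open>m\<close>, and the modulus of a growth chain gives absolute continuity. Only the equation itself has to be
  supplied, almost everywhere.
\<close>

lemma growth_chain_solution:
  assumes km: "k < m" and ch: "growth_chain m k h Q {0..} V"
    and steep: "\<And>i s t. Suc i < m \<Longrightarrow> 0 \<le> s \<Longrightarrow> s \<le> t \<Longrightarrow> (t - s) * V (Suc i) s \<le> V i t - V i s"
    and h: "mono_on {0..} h" "\<And>s. 0 \<le> s \<Longrightarrow> 0 \<le> h s"
    and q: "\<And>t. 0 \<le> t \<Longrightarrow> 0 \<le> q t" "\<And>b. q integrable_on {0..b}"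
    and Q: "\<And>s t. 0 \<le> s \<Longrightarrow> s \<le> t \<Longrightarrow> Q t - Q s = integral {s..t} q"
    and N: "negligible N" "\<And>t. 0 \<le> t \<Longrightarrow> t \<notin> N \<Longrightarrow>
       (V (m - 1) has_vector_derivative f t (\<lambda>i. if i < m then V i t else 0)) (at t within {0..})"
    and a: "\<And>i. i < m \<Longrightarrow> V i 0 = a i"
  shows "is_cauchy_solution m f a \<infinity> (V 0)"
proof -
  have S: "upto_time \<infinity> = {0..}" by (auto simp: upto_time_def)
  have Qm: "Q s \<le> Q t" if "0 \<le> s" "s \<le> t" for s t
  proof -
    have "0 \<le> integral {s..t} q"
      using that by (intro integral_nonneg integrable_on_subinterval[OF q(2)[of t]] q(1)) auto
    thus ?thesis using Q[OF that] by simp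
  qed
  have Qc: "continuous_on {0..b} Q" for b
  proof -
    have "continuous_on {0..b} (\<lambda>t. Q 0 + integral {0..t} q)"
      by (intro continuous_on_add continuous_on_const indefinite_integral_continuous_1 q)
    thus ?thesis by (rule continuous_on_eq) (simp add: Q[OF order_refl, symmetric])
  qed
  have cont: "continuous (at t within {0..}) (V i)" if "i < m" "0 \<le> t" for i t
  proof -
    have "mono_on {0..t + 1} Q" using Qm by (auto intro: mono_onI)
    hence "continuous_on {0..t + 1} (V i)"
      by (intro growth_chain_continuous_on[OF growth_chain_subset[OF ch] that(1) km h(1) _ Qc]) auto
    hence "continuous (at t within {0..t + 1}) (V i)" using that by (simp add: continuous_on_eq_continuous_within)
    moreover have "at t within {0..t + 1} = at t within {0..}"
      by (rule at_within_nhd[of t "{..<t + 1}"]) auto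
    ultimately show ?thesis by simp
  qed
  have der: "(V i has_vector_derivative V (Suc i) t) (at t within {0..})" if "Suc i < m" "0 \<le> t" for i t
    using that by (intro has_vector_derivative_squeezed cont steep growth_chain_slope[OF ch]) auto
  define W where "W i = nth_deriv_within {0..} i (V 0)" for i
  have W_Suc: "W (Suc i) t = D" if "(W i has_vector_derivative D) (at t within {0..})" "0 \<le> t" for i t D
    using vector_derivative_within[OF at_within_atLeast_neq_bot[OF that(2)] that(1)] by (simp add: W_def)
  have W_transform: "(W i has_vector_derivative D) (at t within {0..})"
    if "(V i has_vector_derivative D) (at t within {0..})" "0 \<le> t" "\<And>u. 0 \<le> u \<Longrightarrow> W i u = V i u" for i t D
    using that by (intro has_vector_derivative_transform[of t "{0..}" "W i" "V i"]) auto
  have WV: "W i t = V i t" if "i < m" "0 \<le> t" for i t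
    using that
  proof (induction i arbitrary: t)
    case 0 show ?case by (simp add: W_def)
  next
    case (Suc i)
    have "(W i has_vector_derivative V (Suc i) t) (at t within {0..})"
      using Suc.prems by (intro W_transform der Suc.IH) auto
    thus ?case using Suc.prems by (intro W_Suc) auto
  qed
  have "W i differentiable_on {0..}" if "Suc i < m" for i
    unfolding differentiable_on_def
  proof
    fix t :: real assume "t \<in> {0..}"
    hence "(W i has_vector_derivative V (Suc i) t) (at t within {0..})"
      using that by (intro W_transform der WV) auto
    thus "W i differentiable (at t within {0..})" by (rule differentiableI_vector)
  qed
  moreover have "locally_abs_continuous_on {0..} (W i)" if i: "i < m" for i
    unfolding locally_abs_continuous_on_def
  proof (intro allI impI)
    fix c d :: real assume cd: "c \<le> d" "{c..d} \<subseteq> {0..}"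
    hence c0: "0 \<le> c" by auto
    define B where "B = Max ((\<lambda>j. V j d) ` {..<m})"
    have B: "V j d \<le> B" if "j < m" for j unfolding B_def using that by (intro Max_ge) auto
    have Vd: "0 \<le> V j d" if "j < m" for j using growth_chain_nonneg[OF ch that] c0 cd by simp
    have B0: "0 \<le> B" using B[OF km] Vd[OF km] by linarith
    have H0: "0 \<le> h (V k d)" using h(2) Vd[OF km] by blast
    have qi: "q integrable_on {u..v}" if "c \<le> u" for u v
      using that c0 by (intro integrable_on_subinterval[OF q(2)[of v]]) auto
    show "abs_continuous_on_interval c d (W i)"
    proof (rule abs_continuous_on_interval_dominated[where p = "\<lambda>t. B + h (V k d) * q t"])
      show "(\<lambda>t. B + h (V k d) * q t) integrable_on {c..d}"
        by (intro integrable_add integrable_on_mult_right qi) auto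
      show "0 \<le> B + h (V k d) * q t" if "t \<in> {c..d}" for t using B0 H0 q(1)[of t] that c0 by simp
      fix u v assume uv: "c \<le> u" "u \<le> v" "v \<le> d"
      have "V i v - V i u \<le> B * (v - u) + h (V k d) * (Q v - Q u)"
        using uv c0 by (intro growth_chain_modulus[OF ch i km, of u v d] B h(1) H0 Qm) auto
      also have "\<dots> = integral {u..v} (\<lambda>t. B + h (V k d) * q t)"
        using uv c0 qi[OF uv(1), of v] by (subst Henstock_Kurzweil_Integration.integral_add) (auto simp: Q intro!: integrable_on_mult_right)
      finally show "\<bar>W i v - W i u\<bar> \<le> integral {u..v} (\<lambda>t. B + h (V k d) * q t)"
        using growth_chain_mono[OF ch i, of u v] uv c0 by (simp add: WV[OF i])
    qed
  qed
  moreover have "AE t in lebesgue_on {0..}. W (m - 1) differentiable (at t within {0..}) \<and>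
      W m t = f t (jet {0..} m (V 0) t)"
  proof (subst AE_lebesgue_on_iff_negligible)
    have "W (m - 1) differentiable (at t within {0..}) \<and> W m t = f t (jet {0..} m (V 0) t)"
      if t: "t \<in> {0..} - N" for t
    proof -
      have "(W (m - 1) has_vector_derivative f t (\<lambda>i. if i < m then V i t else 0)) (at t within {0..})"
        using t km by (intro W_transform N(2) WV) auto
      moreover have "jet {0..} m (V 0) t = (\<lambda>i. if i < m then V i t else 0)"
        using t WV by (auto simp: jet_def W_def fun_eq_iff)
      ultimately show ?thesis
        using W_Suc[of "m - 1" _ t] t km by (auto intro: differentiableI_vector)
    qed
    thus "\<exists>N. negligible N \<and> (\<forall>t\<in>{0..} - N. W (m - 1) differentiable (at t within {0..}) \<and>
      W m t = f t (jet {0..} m (V 0) t))" using N(1) by blast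
  qed auto
  ultimately have "is_solution m f \<infinity> (V 0)"
    unfolding is_solution_def Let_def S W_def by blast
  thus ?thesis using WV[of _ 0] a by (simp add: is_cauchy_solution_def S W_def)
qed

section \<open>Extension of solutions\<close>

theorem theorem1:
  fixes m k :: nat
    and f :: "real \<Rightarrow> (nat \<Rightarrow> real) \<Rightarrow> real"
    and q h :: "real \<Rightarrow> real"
    and a :: "nat \<Rightarrow> real"
    and T :: ereal
    and w :: "real \<Rightarrow> real"
  assumes "1 \<le> m" and "k \<le> m - 1"
    and "\<And>t x. 0 \<le> t \<Longrightarrow> x \<in> topspace (Euclidean_space m) \<Longrightarrow> 0 \<le> f t x"
    and "locally_caratheodory m f"
    and "\<And>t. 0 \<le> t \<Longrightarrow> 0 \<le> q t"
    and "locally_integrable q"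
    and "\<And>s. 0 \<le> s \<Longrightarrow> 0 \<le> h s"
    and "mono_on {0..} h"
    and "continuous_on {0..} h"
    and "\<And>s. 0 < s \<Longrightarrow> 0 < h s"
    and "AE t in lebesgue_on {0..}.
           \<forall>x \<in> topspace (Euclidean_space m). (\<forall>i<m. 0 \<le> x i) \<longrightarrow> f t x \<le> q t * h (x k)"
    and "(\<integral>\<^sup>+ s \<in> {1..}.
            ennreal (h s powr (- 1 / real (m - k)) * s powr (1 / real (m - k) - 1)) \<partial>lborel) = \<infinity>"
    and "\<And>i. i < m \<Longrightarrow> 0 \<le> a i"
    and "0 < T"
    and "is_cauchy_solution m f a T w"
  shows "\<exists>v. is_cauchy_solution m f a \<infinity> v \<and> (\<forall>t \<in> upto_time T. v t = w t)"
proof (cases "T = \<infinity>")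
  case True
  thus ?thesis using assms(15) by blast
next
  case False
  with \<open>0 < T\<close> obtain b where T: "T = ereal b" "0 < b" by (cases T) auto
  note nonneg = assms(3) and car = assms(4) and q0 = assms(5) and h0 = assms(7) and hm = assms(8)
    and hc = assms(9) and hp = assms(10) and bound = assms(11) and div = assms(12) and a0 = assms(13)
  have km: "k < m" using assms(1,2) by simp
  have S: "upto_time T = {0..<b}" by (auto simp: upto_time_def T)
  have sol: "is_cauchy_solution m f a (ereal b) w" using assms(15) T by simp
  have qi: "q integrable_on {0..c}" for c
  proof (cases "0 < c")
    case True
    thus ?thesis
      using assms(6) by (auto simp: locally_integrable_def intro: set_lebesgue_integral_eq_integral(1))
  next
    case False
    hence "{0..c} = {} \<or> {0..c} = {0..0}" by auto
    thus ?thesis by (metis integrable_on_empty integrable_on_refl box_real(2))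
  qed
  have qi': "q integrable_on {s..t}" if "0 \<le> s" for s t
    using that by (intro integrable_on_subinterval[OF qi[of t]]) auto
  define Q where "Q t = integral {0..t} q" for t
  have Q_diff: "Q t - Q s = integral {s..t} q" if "0 \<le> s" "s \<le> t" for s t
    using Henstock_Kurzweil_Integration.integral_combine[OF that qi] by (simp add: Q_def)
  have Qm: "mono_on {0..} Q"
  proof (rule mono_onI)
    fix s t :: real assume st: "s \<in> {0..}" "t \<in> {0..}" "s \<le> t"
    hence "0 \<le> integral {s..t} q" by (intro integral_nonneg qi' q0) auto
    thus "Q s \<le> Q t" using Q_diff[of s t] st by simp
  qed
  have Qc: "continuous_on {0..c} Q" for c
    unfolding Q_def by (intro indefinite_integral_continuous_1 qi)
  obtain N where N: "negligible N"
    "\<And>t. 0 \<le> t \<Longrightarrow> t \<notin> N \<Longrightarrow> continuous_map (Euclidean_space m) euclideanreal (f t)"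
    "\<And>t x. 0 \<le> t \<Longrightarrow> t \<notin> N \<Longrightarrow> x \<in> orthant m \<Longrightarrow> f t x \<le> q t * h (x k)"
    by (rule locally_caratheodory_almost_everywhere[OF car bound]) blast
  define z where "z i = nth_deriv_within {0..<b} i w" for i
  have z_chain: "growth_chain m k h Q {0..<b} z"
    and z_steep: "\<And>i s t. Suc i < m \<Longrightarrow> 0 \<le> s \<Longrightarrow> s \<le> t \<Longrightarrow> t < b \<Longrightarrow> (t - s) * z (Suc i) s \<le> z i t - z i s"
    unfolding z_def
    by (rule solution_growth_chain[OF km nonneg N(1,3) q0 qi hm Q_diff a0 sol T(2)]; assumption)+
  have z_init: "z i 0 = a i" if "i < m" for i
    using sol that S T by (simp add: is_cauchy_solution_def z_def)
  obtain B where B: "\<And>y t i. growth_chain m k h Q {0..t} y \<Longrightarrow> 0 \<le> t \<Longrightarrow> t \<le> b \<Longrightarrow>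
      (\<And>i. i < m \<Longrightarrow> y i 0 \<le> a i) \<Longrightarrow> i < m \<Longrightarrow> y i t \<le> B"
  proof -
    have "mono_on {0..b} Q" using Qm by (rule mono_on_subset) auto
    show thesis
      by (rule growth_chain_a_priori_all[OF km a0 hm hc h0 hp div \<open>mono_on {0..b} Q\<close> Qc])
        (assumption, assumption, assumption, rule that, blast)
  qed
  have z_bound: "z i t \<le> B" if "i < m" "t \<in> {0..<b}" for i t
    by (rule B[OF growth_chain_subset[OF z_chain]]) (use that z_init in auto)
  obtain c where c: "\<And>i. 0 \<le> c i" "\<And>i. m \<le> i \<Longrightarrow> c i = 0"
    "\<And>y. (\<And>i t. i < m \<Longrightarrow> t \<in> {0..<b} \<Longrightarrow> y i t = z i t) \<Longrightarrow> (\<And>i. i < m \<Longrightarrow> y i b = c i) \<Longrightarrow>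
       growth_chain m k h Q {0..b} y \<and>
       (\<forall>i s t. Suc i < m \<longrightarrow> 0 \<le> s \<longrightarrow> s \<le> t \<longrightarrow> t \<le> b \<longrightarrow> (t - s) * y (Suc i) s \<le> y i t - y i s)"
    by (rule growth_chain_extend_endpoint[OF z_chain T(2) km hm hc Qc z_bound z_steep]) blast+
  \<comment> \<open>off \<open>N\<close> nothing changes, and on \<open>N\<close> the zero function satisfies all requirements\<close>
  define f' where "f' t x = (if t \<in> N then 0 else f t x)" for t x
  interpret dominated_caratheodory m k f' q h Q b c
  proof
    show "k < m" by (rule km)
    show "0 \<le> f' t x" if "b \<le> t" "x \<in> orthant m" for t x
      using nonneg[of t x] that T(2) orthant_subset_topspace by (auto simp: f'_def)
    show "f' t x \<le> q t * h (x k)" if "b \<le> t" "x \<in> orthant m" for t x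
      using N(3)[of t x] that T(2) q0[of t] h0[of "x k"] by (auto simp: f'_def orthant_def)
    show "(\<lambda>t. f' t x) integrable_on {b..d}" if x: "x \<in> orthant m" for x d
      unfolding f'_def
    proof (rule integrable_off_negligible[where G = "\<lambda>t. q t * h (x k)", OF _ N(1)])
      show "(\<lambda>t. f t x) \<in> borel_measurable (lebesgue_on {0..})"
        using car x orthant_subset_topspace unfolding locally_caratheodory_def by blast
      show "(\<lambda>t. q t * h (x k)) integrable_on {b..d}"
        using T(2) by (intro integrable_on_mult_left qi') simp
      show "\<bar>f t x\<bar> \<le> q t * h (x k)" if "t \<in> {b..d}" "t \<notin> N" for t
      proof -
        have "x \<in> topspace (Euclidean_space m)" using x orthant_subset_topspace by blast
        thus ?thesis using N(3)[of t x] nonneg[of t x] that x T(2) by simp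
      qed
      show "0 \<le> q t * h (x k)" if "t \<in> {b..d}" for t
        using q0[of t] h0[of "x k"] that x T(2) by (auto simp: orthant_def)
    qed (use T(2) in simp)
    show "(\<lambda>n. f' t (X n)) \<longlonglongrightarrow> f' t x"
      if "b \<le> t" "\<And>n. X n \<in> orthant m" "x \<in> orthant m" "\<And>i. (\<lambda>n. X n i) \<longlonglongrightarrow> x i" for t X x
    proof (cases "t \<in> N")
      case False
      have "(\<lambda>n. f t (X n)) \<longlonglongrightarrow> f t x"
        using that T(2) orthant_subset_topspace[of m] False
        by (intro continuous_map_Euclidean_space_sequentially[OF N(2)]) auto
      thus ?thesis using False by (simp add: f'_def)
    qed (simp add: f'_def)
    show "q integrable_on {b..d}" for d using T(2) by (intro qi') simp
    show "c \<in> orthant m" using c by (simp add: orthant_def)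
  qed (use q0 Q_diff T(2) hm hc h0 hp div in auto)
  obtain y where y: "\<And>i. y i b = c i" "growth_chain m k h Q {b..} y"
    "\<And>i s t. Suc i < m \<Longrightarrow> b \<le> s \<Longrightarrow> s \<le> t \<Longrightarrow> (t - s) * y (Suc i) s \<le> y i t - y i s"
    "\<And>t. b \<le> t \<Longrightarrow> (\<lambda>i. y i t) \<in> orthant m"
    "\<And>t. b \<le> t \<Longrightarrow> (\<lambda>s. f' s (\<lambda>i. y i s)) integrable_on {b..t}"
    "\<And>t. b \<le> t \<Longrightarrow> y (m - 1) t = c (m - 1) + integral {b..t} (\<lambda>s. f' s (\<lambda>i. y i s))"
    by (rule global_solution) blast
  define V where "V i t = (if t < b then z i t else y i t)" for i t
  have V_left: "growth_chain m k h Q {0..b} V"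
    and V_left_steep: "\<And>i s t. Suc i < m \<Longrightarrow> 0 \<le> s \<Longrightarrow> s \<le> t \<Longrightarrow> t \<le> b \<Longrightarrow> (t - s) * V (Suc i) s \<le> V i t - V i s"
    using c(3)[of V] y(1) by (auto simp: V_def)
  have V_right: "growth_chain m k h Q {b..} V"
    using y(2) unfolding growth_chain_def by (simp add: V_def)
  have V_chain: "growth_chain m k h Q {0..} V"
    using growth_chain_glue[OF V_left V_right _ km hm Qm] T(2) by simp
  have V_steep: "(t - s) * V (Suc i) s \<le> V i t - V i s" if i: "Suc i < m" and st: "0 \<le> s" "s \<le> t" for i s t
  proof -
    have right: "(t - s) * V (Suc i) s \<le> V i t - V i s" if "b \<le> s" "s \<le> t" for s t
      using y(3)[OF i that] that by (simp add: V_def)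
    have mono: "V (Suc i) s \<le> V (Suc i) b" if "0 \<le> s" "s \<le> b" for s
      using growth_chain_mono[OF V_chain i] that by simp
    show ?thesis by (rule steep_glue[OF V_left_steep[OF i] right mono st])
  qed
  have "AE t in lebesgue_on {0..<b}. z (m - 1) differentiable (at t within {0..<b}) \<and>
      nth_deriv_within {0..<b} m w t = f t (jet {0..<b} m w t)"
    using sol unfolding is_cauchy_solution_def is_solution_def Let_def S[unfolded T] z_def by blast
  then obtain N1 where N1: "negligible N1" "\<And>t. t \<in> {0..<b} - N1 \<Longrightarrow> z (m - 1) differentiable (at t within {0..<b}) \<and>
      nth_deriv_within {0..<b} m w t = f t (jet {0..<b} m w t)"
    by (subst (asm) AE_lebesgue_on_iff_negligible) auto
  obtain N2 where N2: "negligible N2" "\<And>t. b < t \<Longrightarrow> t \<notin> N2 \<Longrightarrow>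
       ((\<lambda>u. integral {b..u} (\<lambda>s. f' s (\<lambda>i. y i s))) has_vector_derivative f' t (\<lambda>i. y i t)) (at t)"
    by (rule has_vector_derivative_integral_ae[OF y(5)]) blast+
  have m1: "Suc (m - 1) = m" "m - 1 < m" using km by auto
  have "is_cauchy_solution m f a \<infinity> (V 0)"
  proof (rule growth_chain_solution[OF km V_chain V_steep hm h0 q0 qi Q_diff])
    show "negligible ({0, b} \<union> N \<union> N1 \<union> N2)" using N(1) N1(1) N2(1) by (simp add: negligible_insert)
    show "V i 0 = a i" if "i < m" for i using z_init[OF that] T(2) by (simp add: V_def)
    fix t assume t: "0 \<le> t" "t \<notin> {0, b} \<union> N \<union> N1 \<union> N2"
    have "(V (m - 1) has_vector_derivative f t (\<lambda>i. if i < m then V i t else 0)) (at t)"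
    proof (cases "t < b")
      case True
      hence tin: "t \<in> {0..<b} - N1" "t \<in> {0<..<b}" using t by auto
      \<comment> \<open>away from 0 the one-sided derivatives of the definition are ordinary ones\<close>
      have "at t within {0..<b} = at t"
        by (rule at_within_open_subset[of t "{0<..<b}"]) (use tin in auto)
      hence "(z (m - 1) has_vector_derivative vector_derivative (z (m - 1)) (at t within {0..<b})) (at t)"
        using N1(2)[OF tin(1)] by (simp add: vector_derivative_works)
      also have "vector_derivative (z (m - 1)) (at t within {0..<b}) = f t (jet {0..<b} m w t)"
        using nth_deriv_within.simps(2)[of "{0..<b}" "m - 1" w] m1(1) N1(2)[OF tin(1)] by (simp add: z_def)
      also have "jet {0..<b} m w t = (\<lambda>i. if i < m then V i t else 0)"
        using True by (simp add: jet_def V_def z_def fun_eq_iff)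
      finally show ?thesis
        by (rule has_vector_derivative_transform_within_open[of _ _ t "{0<..<b}"]) (use tin in \<open>auto simp: V_def\<close>)
    next
      case False
      hence bt: "b < t" using t by auto
      have "((\<lambda>u. c (m - 1) + integral {b..u} (\<lambda>s. f' s (\<lambda>i. y i s))) has_vector_derivative 0 + f' t (\<lambda>i. y i t)) (at t)"
        using N2(2)[OF bt] t by (intro has_vector_derivative_add has_vector_derivative_const) auto
      also have "0 + f' t (\<lambda>i. y i t) = f t (\<lambda>i. if i < m then V i t else 0)"
      proof -
        have "(\<lambda>i. if i < m then V i t else 0) = (\<lambda>i. y i t)"
          using y(4)[of t] bt by (auto simp: V_def orthant_def fun_eq_iff)
        thus ?thesis using t by (simp add: f'_def)
      qed
      finally show ?thesis
        by (rule has_vector_derivative_transform_within_open[of _ _ t "{b<..}"]) (use bt y(6) in \<open>auto simp: V_def\<close>)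
    qed
    thus "(V (m - 1) has_vector_derivative f t (\<lambda>i. if i < m then V i t else 0)) (at t within {0..})"
      by (rule has_vector_derivative_at_within)
  qed
  moreover have "V 0 t = w t" if "t \<in> upto_time T" for t
    using that unfolding S by (simp add: V_def z_def)
  ultimately show ?thesis by blast
qed

end
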